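(* Given a two-counter machine $M$ and a configuration $s\in\mathcal{S}\Sigma_M$ with $s\le T_M$, one can compute a term $\rho\in\mathcal{T}\ddot\Sigma_M$ such that: if $s\to_{R_M}^* c_1$, then the inequality $$s_rR_M^*\le \Sigma_M^*(C_M+c_1)_r+\Sigma_M^*\Sigma_M^{\neq}\rho$$ holds in $\mathcal{T}\ddot\Sigma_M$ (i.e. is derivable in pre-Kleene algebra).
   Context: Pre-Kleene algebra: constants $0,1$, operations $+,\cdot,{}^*$ with $(+,0)$ a commutative idempotent monoid, $(\cdot,1)$ a monoid, two-sided distributivity, $0$ absorbing, and $x^*=1+xx^*$; order $x\le y$ iff $x+y=y$. A commutable set is a set with a reflexive symmetric relation $\sim$ (discrete if $\sim$ is equality). $\mathcal{S}Y$: strings over $Y$ modulo $xy=yx$ for $x\sim y$. $\mathcal{T}Y$: free pre-Kleene algebra on $Y$ subject to $xy=yx$ for $x\sim y$ (strings embed in it). A finite set of elements is identified with their sum. $\ddot Y$ is $\{y_l\}\cup\{y_r\}$ ($y\in Y$) with $y_l\sim y'_r$ always, $y_l\sim y'_l$ iff $y\sim y'$, $y_r\sim y'_r$ iff $y\sim y'$. $(-)_l,(-)_r:\mathcal{T}Y\to\mathcal{T}\ddot Y$ send $y$ to $y_l$, resp. $y_r$; a term or string over $Y$ without subscript is regarded in $\mathcal{T}\ddot Y$ via $y\mapsto y_ly_r$. For strings $s,s'$ and $e\in\mathcal{T}\ddot Y$, $s\to_e s'$ means $s_ls'_r\le e$; $\to_e^*$ is its reflexive transitive closure. A two-counter machine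 $M=(Q_M,\dot q,\iota)$: finite state set $Q_M$, initial state $\dot q$, $\iota:Q_M\to I_M$ with instructions $\mathrm{Inc}(r,q)$, $\mathrm{If}(r,q,q')$ ($r\in\{1,2\}$), $\mathrm{Halt}(x)$ ($x\in\{0,1\}$). $\Sigma_M=Q_M\uplus\{a,b,c_0,c_1\}$ discrete; $C_M=a^*b^*Q_M$, $T_M=C_M+c_0+c_1$ in $\mathcal{T}\Sigma_M$. In $\mathcal{T}\ddot\Sigma_M$: $[\![\mathrm{Inc}(1,q)]\!]=a_r(a_la_r)^*(b_lb_r)^*q_r$, $[\![\mathrm{Inc}(2,q)]\!]=(a_la_r)^*b_r(b_lb_r)^*q_r$, $[\![\mathrm{If}(1,q_1,q_2)]\!]=(b_lb_r)^*(q_1)_r+a_l(a_la_r)^*(b_lb_r)^*(q_2)_r$, $[\![\mathrm{If}(2,q_1,q_2)]\!]=(a_la_r)^*(q_1)_r+(a_la_r)^*b_l(b_lb_r)^*(q_2)_r$, $[\![\mathrm{Halt}(x)]\!]=(c_x)_r$; $R_M=\sum_{q\in Q_M}[\![\iota(q)]\!]q_l$. $\Sigma_M^*=(\sum_{x\in\Sigma_M}x_lx_r)^*$ and $\Sigma_M^{\neq}=\sum_{x\neq y}x_ly_r$ ($x,y\in\Sigma_M$). *)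

theory Defs
  imports Main "HOL-Library.Nat_Bijection"
begin

section \<open>Commutable sets, strings and free pre-Kleene algebras\<close>

record 'a comset =
  carr :: "'a set"
  comm :: "'a \<Rightarrow> 'a \<Rightarrow> bool"

definition commutable_set :: "'a comset \<Rightarrow> bool" where
  "commutable_set Y \<longleftrightarrow>
     (\<forall>x\<in>carr Y. comm Y x x) \<and> (\<forall>x\<in>carr Y. \<forall>y\<in>carr Y. comm Y x y \<longrightarrow> comm Y y x)"

definition discrete_comset :: "'a set \<Rightarrow> 'a comset" where
  "discrete_comset X = \<lparr>carr = X, comm = (=)\<rparr>"

text \<open>
  \<open>str_eq Y\<close> is the monoid congruence on strings over \<open>Y\<close> generated by \<open>xy = yx\<close> for \<open>x \<sim> y\<close>;
  the elements of \<open>\<S>Y\<close> are its classes \<open>str_class Y w\<close> for \<open>w \<in> lists (carr Y)\<close>.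
\<close>

inductive str_eq :: "'a comset \<Rightarrow> 'a list \<Rightarrow> 'a list \<Rightarrow> bool" for Y where
  str_refl: "u \<in> lists (carr Y) \<Longrightarrow> str_eq Y u u"
| str_sym: "str_eq Y u v \<Longrightarrow> str_eq Y v u"
| str_trans: "str_eq Y u v \<Longrightarrow> str_eq Y v w \<Longrightarrow> str_eq Y u w"
| str_swap: "u \<in> lists (carr Y) \<Longrightarrow> v \<in> lists (carr Y) \<Longrightarrow> x \<in> carr Y \<Longrightarrow> y \<in> carr Y \<Longrightarrow> comm Y x y
    \<Longrightarrow> str_eq Y (u @ [x, y] @ v) (u @ [y, x] @ v)"

definition str_class :: "'a comset \<Rightarrow> 'a list \<Rightarrow> 'a list set" where
  "str_class Y w = {v. str_eq Y w v}"

datatype 'a ktm =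
    KZero
  | KOne
  | Var 'a
  | KPlus "'a ktm" "'a ktm" (infixl "\<oplus>" 65)
  | KTimes "'a ktm" "'a ktm" (infixl "\<odot>" 70)
  | KStar "'a ktm"

definition terms :: "'a comset \<Rightarrow> 'a ktm set" where
  "terms Y = {t. set_ktm t \<subseteq> carr Y}"

text \<open>
  Elements of the free pre-Kleene algebra \<open>\<T>Y\<close> are given by terms over \<open>Y\<close>; two terms denote the
  same element iff they are related by \<open>pka_eq Y\<close>, derivability from the pre-Kleene algebra axioms
  and the commutativity conditions of \<open>Y\<close>.
\<close>

inductive pka_eq :: "'a comset \<Rightarrow> 'a ktm \<Rightarrow> 'a ktm \<Rightarrow> bool" for Y where
  eq_refl: "t \<in> terms Y \<Longrightarrow> pka_eq Y t t"
| eq_sym: "pka_eq Y t u \<Longrightarrow> pka_eq Y u t"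
| eq_trans: "pka_eq Y t u \<Longrightarrow> pka_eq Y u v \<Longrightarrow> pka_eq Y t v"
| cong_plus: "pka_eq Y t t' \<Longrightarrow> pka_eq Y u u' \<Longrightarrow> pka_eq Y (t \<oplus> u) (t' \<oplus> u')"
| cong_times: "pka_eq Y t t' \<Longrightarrow> pka_eq Y u u' \<Longrightarrow> pka_eq Y (t \<odot> u) (t' \<odot> u')"
| cong_star: "pka_eq Y t t' \<Longrightarrow> pka_eq Y (KStar t) (KStar t')"
| plus_assoc: "t \<in> terms Y \<Longrightarrow> u \<in> terms Y \<Longrightarrow> v \<in> terms Y
    \<Longrightarrow> pka_eq Y ((t \<oplus> u) \<oplus> v) (t \<oplus> (u \<oplus> v))"
| plus_comm: "t \<in> terms Y \<Longrightarrow> u \<in> terms Y \<Longrightarrow> pka_eq Y (t \<oplus> u) (u \<oplus> t)"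
| plus_zero: "t \<in> terms Y \<Longrightarrow> pka_eq Y (t \<oplus> KZero) t"
| plus_idem: "t \<in> terms Y \<Longrightarrow> pka_eq Y (t \<oplus> t) t"
| times_assoc: "t \<in> terms Y \<Longrightarrow> u \<in> terms Y \<Longrightarrow> v \<in> terms Y
    \<Longrightarrow> pka_eq Y ((t \<odot> u) \<odot> v) (t \<odot> (u \<odot> v))"
| one_times: "t \<in> terms Y \<Longrightarrow> pka_eq Y (KOne \<odot> t) t"
| times_one: "t \<in> terms Y \<Longrightarrow> pka_eq Y (t \<odot> KOne) t"
| distrib_left: "t \<in> terms Y \<Longrightarrow> u \<in> terms Y \<Longrightarrow> v \<in> terms Y
    \<Longrightarrow> pka_eq Y (t \<odot> (u \<oplus> v)) (t \<odot> u \<oplus> t \<odot> v)"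
| distrib_right: "t \<in> terms Y \<Longrightarrow> u \<in> terms Y \<Longrightarrow> v \<in> terms Y
    \<Longrightarrow> pka_eq Y ((t \<oplus> u) \<odot> v) (t \<odot> v \<oplus> u \<odot> v)"
| zero_times: "t \<in> terms Y \<Longrightarrow> pka_eq Y (KZero \<odot> t) KZero"
| times_zero: "t \<in> terms Y \<Longrightarrow> pka_eq Y (t \<odot> KZero) KZero"
| star_unfold: "t \<in> terms Y \<Longrightarrow> pka_eq Y (KStar t) (KOne \<oplus> t \<odot> KStar t)"
| var_comm: "x \<in> carr Y \<Longrightarrow> y \<in> carr Y \<Longrightarrow> comm Y x y
    \<Longrightarrow> pka_eq Y (Var x \<odot> Var y) (Var y \<odot> Var x)"

definition pka_le :: "'a comset \<Rightarrow> 'a ktm \<Rightarrow> 'a ktm \<Rightarrow> bool" where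
  "pka_le Y t u \<longleftrightarrow> pka_eq Y (t \<oplus> u) u"

definition str_term :: "'a list \<Rightarrow> 'a ktm" where
  "str_term w = foldr (\<lambda>y t. Var y \<odot> t) w KOne"

text \<open>Finite sums are taken along a list; up to \<open>pka_eq\<close> neither order nor repetition matters.\<close>

definition ksum :: "'a ktm list \<Rightarrow> 'a ktm" where
  "ksum ts = foldr (\<oplus>) ts KZero"

primrec ksubst :: "('a \<Rightarrow> 'b ktm) \<Rightarrow> 'a ktm \<Rightarrow> 'b ktm" where
  "ksubst h KZero = KZero"
| "ksubst h KOne = KOne"
| "ksubst h (Var y) = h y"
| "ksubst h (t \<oplus> u) = ksubst h t \<oplus> ksubst h u"
| "ksubst h (t \<odot> u) = ksubst h t \<odot> ksubst h u"
| "ksubst h (KStar t) = KStar (ksubst h t)"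

section \<open>Reg2-track alphabets and the relation of a term\<close>

datatype 'a dd = Lft 'a | Rgt 'a

fun dd_comm :: "('a \<Rightarrow> 'a \<Rightarrow> bool) \<Rightarrow> 'a dd \<Rightarrow> 'a dd \<Rightarrow> bool" where
  "dd_comm r (Lft x) (Lft y) = r x y"
| "dd_comm r (Rgt x) (Rgt y) = r x y"
| "dd_comm r (Lft x) (Rgt y) = True"
| "dd_comm r (Rgt x) (Lft y) = True"

definition ddot :: "'a comset \<Rightarrow> 'a dd comset" where
  "ddot Y = \<lparr>carr = Lft ` carr Y \<union> Rgt ` carr Y, comm = dd_comm (comm Y)\<rparr>"

definition lterm :: "'a ktm \<Rightarrow> 'a dd ktm" where
  "lterm = ksubst (\<lambda>y. Var (Lft y))"

definition rterm :: "'a ktm \<Rightarrow> 'a dd ktm" where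
  "rterm = ksubst (\<lambda>y. Var (Rgt y))"

text \<open>The implicit reading of an unsubscripted term over \<open>Y\<close> in the two-track algebra.\<close>

definition bterm :: "'a ktm \<Rightarrow> 'a dd ktm" where
  "bterm = ksubst (\<lambda>y. Var (Lft y) \<odot> Var (Rgt y))"

definition trans_rel :: "'a comset \<Rightarrow> 'a dd ktm \<Rightarrow> ('a list set \<times> 'a list set) set" where
  "trans_rel Y e = {(str_class Y w, str_class Y w') | w w'.
     w \<in> lists (carr Y) \<and> w' \<in> lists (carr Y) \<and>
     pka_le (ddot Y) (lterm (str_term w) \<odot> rterm (str_term w')) e}"

section \<open>Reg2-counter machines\<close>

datatype counter = Reg1 | Reg2

text \<open>The halting values \<open>0\<close> and \<open>1\<close> are \<open>False\<close> and \<open>True\<close>.\<close>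

datatype instruction = Inc counter nat | IfZ counter nat nat | Halt bool

text \<open>
  So that machines can be inputs of a computation, states are natural numbers; the state set is an
  arbitrary finite set of them. The function \<open>instr\<close> matters on \<open>states\<close> only.
\<close>

record machine =
  states :: "nat set"
  init :: nat
  instr :: "nat \<Rightarrow> instruction"

fun targets :: "instruction \<Rightarrow> nat set" where
  "targets (Inc r q) = {q}"
| "targets (IfZ r q q') = {q, q'}"
| "targets (Halt x) = {}"

definition two_counter_machine :: "machine \<Rightarrow> bool" where
  "two_counter_machine M \<longleftrightarrow> finite (states M) \<and> init M \<in> states M \<and>
     (\<forall>q\<in>states M. targets (instr M q) \<subseteq> states M)"

datatype sym = St nat | SymA | SymB | SymC bool

definition state_list :: "machine \<Rightarrow> nat list" where
  "state_list M = sorted_list_of_set (states M)"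

definition sym_list :: "machine \<Rightarrow> sym list" where
  "sym_list M = map St (state_list M) @ [SymA, SymB, SymC False, SymC True]"

definition Sig :: "machine \<Rightarrow> sym comset" where
  "Sig M = discrete_comset (St ` states M \<union> {SymA, SymB, SymC False, SymC True})"

definition CM :: "machine \<Rightarrow> sym ktm" where
  "CM M = KStar (Var SymA) \<odot> KStar (Var SymB) \<odot> ksum (map (\<lambda>q. Var (St q)) (state_list M))"

definition TM :: "machine \<Rightarrow> sym ktm" where
  "TM M = CM M \<oplus> Var (SymC False) \<oplus> Var (SymC True)"

abbreviation vl :: "'a \<Rightarrow> 'a dd ktm" where "vl x \<equiv> Var (Lft x)"
abbreviation vr :: "'a \<Rightarrow> 'a dd ktm" where "vr x \<equiv> Var (Rgt x)"

fun instr_term :: "instruction \<Rightarrow> sym dd ktm" where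
  "instr_term (Inc Reg1 q) =
     vr SymA \<odot> KStar (vl SymA \<odot> vr SymA) \<odot> KStar (vl SymB \<odot> vr SymB) \<odot> vr (St q)"
| "instr_term (Inc Reg2 q) =
     KStar (vl SymA \<odot> vr SymA) \<odot> vr SymB \<odot> KStar (vl SymB \<odot> vr SymB) \<odot> vr (St q)"
| "instr_term (IfZ Reg1 q1 q2) =
     KStar (vl SymB \<odot> vr SymB) \<odot> vr (St q1) \<oplus>
     vl SymA \<odot> KStar (vl SymA \<odot> vr SymA) \<odot> KStar (vl SymB \<odot> vr SymB) \<odot> vr (St q2)"
| "instr_term (IfZ Reg2 q1 q2) =
     KStar (vl SymA \<odot> vr SymA) \<odot> vr (St q1) \<oplus>
     KStar (vl SymA \<odot> vr SymA) \<odot> vl SymB \<odot> KStar (vl SymB \<odot> vr SymB) \<odot> vr (St q2)"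
| "instr_term (Halt x) = vr (SymC x)"

definition RM :: "machine \<Rightarrow> sym dd ktm" where
  "RM M = ksum (map (\<lambda>q. instr_term (instr M q) \<odot> vl (St q)) (state_list M))"

definition Sig_star :: "machine \<Rightarrow> sym dd ktm" where
  "Sig_star M = bterm (KStar (ksum (map Var (sym_list M))))"

definition Sig_neq :: "machine \<Rightarrow> sym dd ktm" where
  "Sig_neq M = ksum [vl x \<odot> vr y. x \<leftarrow> sym_list M, y \<leftarrow> sym_list M, x \<noteq> y]"

section \<open>Computability\<close>

text \<open>
  Partial recursive functions, in the unary presentation based on the Cantor pairing
  \<open>prod_encode\<close>: initial functions, pairing, composition, primitive recursion and unbounded search.
\<close>

definition search :: "(nat \<Rightarrow> nat option) \<Rightarrow> nat option" where
  "search g = (if \<exists>n. g n = Some 0 \<and> (\<forall>m<n. g m \<noteq> None)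
               then Some (LEAST n. g n = Some 0) else None)"

inductive partial_recursive :: "(nat \<Rightarrow> nat option) \<Rightarrow> bool" where
  pr_zero: "partial_recursive (\<lambda>n. Some 0)"
| pr_succ: "partial_recursive (\<lambda>n. Some (Suc n))"
| pr_fst: "partial_recursive (\<lambda>n. Some (fst (prod_decode n)))"
| pr_snd: "partial_recursive (\<lambda>n. Some (snd (prod_decode n)))"
| pr_pair: "partial_recursive f \<Longrightarrow> partial_recursive g \<Longrightarrow>
    partial_recursive (\<lambda>n. Option.bind (f n) (\<lambda>x. Option.bind (g n) (\<lambda>y. Some (prod_encode (x, y)))))"
| pr_comp: "partial_recursive f \<Longrightarrow> partial_recursive g \<Longrightarrow>
    partial_recursive (\<lambda>n. Option.bind (g n) f)"
| pr_prec: "partial_recursive f \<Longrightarrow> partial_recursive g \<Longrightarrow>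
    partial_recursive (\<lambda>n. rec_nat (f (fst (prod_decode n)))
      (\<lambda>k r. Option.bind r (\<lambda>i. g (prod_encode (fst (prod_decode n), prod_encode (k, i)))))
      (snd (prod_decode n)))"
| pr_search: "partial_recursive f \<Longrightarrow>
    partial_recursive (\<lambda>n. search (\<lambda>k. f (prod_encode (n, k))))"

text \<open>Goedel numberings of the inputs (a machine and a string) and of the output (a term).\<close>

fun counter_code :: "counter \<Rightarrow> nat" where
  "counter_code Reg1 = 0"
| "counter_code Reg2 = 1"

fun instr_code :: "instruction \<Rightarrow> nat" where
  "instr_code (Inc r q) = prod_encode (0, prod_encode (counter_code r, q))"
| "instr_code (IfZ r q q') = prod_encode (1, prod_encode (counter_code r, prod_encode (q, q')))"
| "instr_code (Halt x) = prod_encode (2, of_bool x)"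

definition machine_code :: "machine \<Rightarrow> nat" where
  "machine_code M = prod_encode (init M,
     list_encode (map (\<lambda>q. prod_encode (q, instr_code (instr M q))) (state_list M)))"

fun sym_code :: "sym \<Rightarrow> nat" where
  "sym_code (St q) = prod_encode (0, q)"
| "sym_code SymA = prod_encode (1, 0)"
| "sym_code SymB = prod_encode (2, 0)"
| "sym_code (SymC x) = prod_encode (3, of_bool x)"

definition input_code :: "machine \<Rightarrow> sym list \<Rightarrow> nat" where
  "input_code M w = prod_encode (machine_code M, list_encode (map sym_code w))"

fun dd_code :: "sym dd \<Rightarrow> nat" where
  "dd_code (Lft x) = prod_encode (0, sym_code x)"
| "dd_code (Rgt x) = prod_encode (1, sym_code x)"

primrec term_code :: "sym dd ktm \<Rightarrow> nat" where
  "term_code KZero = prod_encode (0, 0)"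
| "term_code KOne = prod_encode (1, 0)"
| "term_code (Var x) = prod_encode (2, dd_code x)"
| "term_code (t \<oplus> u) = prod_encode (3, prod_encode (term_code t, term_code u))"
| "term_code (t \<odot> u) = prod_encode (4, prod_encode (term_code t, term_code u))"
| "term_code (KStar t) = prod_encode (5, term_code t)"

section \<open>Adequacy of the definitions\<close>

lemma commutable_discrete: "commutable_set (discrete_comset X)"
  by (simp add: commutable_set_def discrete_comset_def)

lemma commutable_ddot: "commutable_set Y \<Longrightarrow> commutable_set (ddot Y)"
  unfolding commutable_set_def ddot_def by (simp add: ball_Un)

lemma set_sym_list: "finite (states M) \<Longrightarrow> set (sym_list M) = carr (Sig M)"
  by (auto simp: sym_list_def state_list_def Sig_def discrete_comset_def)

lemma str_class_discrete:
  assumes "w \<in> lists X"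
  shows "str_class (discrete_comset X) w = {w}"
proof -
  have "str_eq (discrete_comset X) u v \<Longrightarrow> u = v" for u v :: "'a list"
    by (induction rule: str_eq.induct) (auto simp: discrete_comset_def)
  moreover have "str_eq (discrete_comset X) w w"
    using assms by (intro str_refl) (simp add: discrete_comset_def)
  ultimately show ?thesis unfolding str_class_def by blast
qed

lemma pka_eq_terms: "pka_eq Y t u \<Longrightarrow> t \<in> terms Y \<and> u \<in> terms Y"
  by (induction rule: pka_eq.induct) (auto simp: terms_def)

lemma counter_code_inject: "counter_code r = counter_code r' \<longleftrightarrow> r = r'"
  by (cases r; cases r') simp_all

lemma instr_code_inject: "instr_code i = instr_code j \<longleftrightarrow> i = j"
  by (cases i; cases j) (auto simp: prod_encode_eq counter_code_inject)

lemma sym_code_inject: "sym_code x = sym_code y \<longleftrightarrow> x = y"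
  by (cases x; cases y) (auto simp: prod_encode_eq)

lemma dd_code_inject: "dd_code x = dd_code y \<longleftrightarrow> x = y"
  by (cases x; cases y) (auto simp: prod_encode_eq sym_code_inject)

lemma term_code_inject: "term_code t = term_code u \<longleftrightarrow> t = u"
proof (induction t arbitrary: u)
  case KZero show ?case by (cases u) (auto simp: prod_encode_eq)
next
  case KOne show ?case by (cases u) (auto simp: prod_encode_eq)
next
  case (Var x) show ?case by (cases u) (auto simp: prod_encode_eq dd_code_inject)
next
  case (KPlus t1 t2) thus ?case by (cases u) (auto simp: prod_encode_eq)
next
  case (KTimes t1 t2) thus ?case by (cases u) (auto simp: prod_encode_eq)
next
  case (KStar t) thus ?case by (cases u) (auto simp: prod_encode_eq)
qed

lemma input_code_inject:
  assumes "two_counter_machine M" "two_counter_machine M'" "input_code M w = input_code M' w'"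
  shows "states M = states M'" "init M = init M'" "\<forall>q\<in>states M. instr M q = instr M' q" "w = w'"
proof -
  let ?f = "\<lambda>M q. prod_encode (q, instr_code (instr M q))"
  have eq: "init M = init M'" "map (?f M) (state_list M) = map (?f M') (state_list M')"
    and sw: "map sym_code w = map sym_code w'"
    using assms(3) by (auto simp: input_code_def machine_code_def prod_encode_eq list_encode_eq)
  have "map (\<lambda>q. fst (prod_decode (?f M q))) (state_list M) =
        map (\<lambda>q. fst (prod_decode (?f M' q))) (state_list M')"
    using arg_cong[OF eq(2), of "map (fst \<circ> prod_decode)"] by (simp add: comp_def)
  hence sl: "state_list M = state_list M'" by simp
  have fin: "finite (states M)" "finite (states M')"
    using assms by (auto simp: two_counter_machine_def)
  show st: "states M = states M'"
    using arg_cong[OF sl, of set] fin by (simp add: state_list_def)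
  show "init M = init M'" by fact
  show "\<forall>q\<in>states M. instr M q = instr M' q"
  proof
    fix q assume "q \<in> states M"
    hence "q \<in> set (state_list M)" using fin by (simp add: state_list_def)
    thus "instr M q = instr M' q"
      using eq(2) unfolding sl by (auto simp: prod_encode_eq instr_code_inject)
  qed
  have "inj sym_code" by (simp add: inj_def sym_code_inject)
  thus "w = w'" using sw by (simp add: inj_map_eq_map)
qed

end

theory Submission
  imports Defs
begin

text \<open>
  The term is \<open>\<rho> = Z\<^sup>* (a\<^sub>l a\<^sub>r)\<^sup>* Z\<^sup>* (b\<^sub>l b\<^sub>r)\<^sup>* Z\<^sup>* R\<^sup>*\<close>, where \<open>Z\<close> is the sum of all letters of both
  tracks; it depends on the machine only. A product \<open>s\<^sub>r R\<close> is read with the right-track word as a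
  queue: since left letters commute with right letters, a left letter meets the front of the queue
  and a right letter is appended to its end. If the left letter equals the front, both merge into
  a factor of \<open>\<Sigma>\<^sup>*\<close>; if not, they form a factor of \<open>\<Sigma>\<^sup>\<noteq>\<close>, and what remains (a word, followed by
  the rest of an instruction, followed by \<open>R\<^sup>*\<close>) lies below \<open>\<rho>\<close>. Unfolding each star as often as the
  length of \<open>s\<close> requires gives \<open>s\<^sub>r R \<le> s s'\<^sub>r + \<Sigma>\<^sup>* \<Sigma>\<^sup>\<noteq> \<rho>\<close> for the successor \<open>s'\<close> of \<open>s\<close>, and no
  successor exists for \<open>c\<^sub>1\<close>. Hence \<open>R\<^sup>*\<close> has to be unfolded only as often as the run has steps, and no
  induction principle for the star is needed.
\<close>

section \<open>Total recursive functions\<close>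

definition recursive :: "(nat \<Rightarrow> nat) \<Rightarrow> bool" where
  "recursive h \<longleftrightarrow> partial_recursive (\<lambda>n. Some (h n))"

lemma recursive_fst: "recursive (\<lambda>n. fst (prod_decode n))"
  and recursive_snd: "recursive (\<lambda>n. snd (prod_decode n))"
  and recursive_Suc: "recursive Suc"
  unfolding recursive_def by (rule pr_fst pr_snd pr_succ)+

lemma recursive_comp: "recursive f \<Longrightarrow> recursive g \<Longrightarrow> recursive (\<lambda>n. f (g n))"
  unfolding recursive_def by (drule (1) pr_comp) simp

lemma recursive_pair: "recursive f \<Longrightarrow> recursive g \<Longrightarrow> recursive (\<lambda>n. prod_encode (f n, g n))"
  unfolding recursive_def by (drule (1) pr_pair) simp

lemma recursive_id: "recursive (\<lambda>n. n)"
  using recursive_pair[OF recursive_fst recursive_snd] by simp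

lemma recursive_const: "recursive (\<lambda>n. c)"
proof (induction c)
  case 0
  show ?case unfolding recursive_def by (rule pr_zero)
next
  case (Suc c)
  show ?case using recursive_comp[OF recursive_Suc Suc] .
qed

lemmas recursive_fst_comp = recursive_comp[OF recursive_fst]
  and recursive_snd_comp = recursive_comp[OF recursive_snd]

text \<open>\<open>pr_prec\<close> takes parameter and count from one paired input. Composing it
  with the pairing of n and \<open>m n\<close> frees the count, and for total functions the binds on
  options collapse.\<close>

lemma recursive_rec_nat:
  assumes "recursive b" "recursive c" "recursive m"
  shows "recursive (\<lambda>n. rec_nat (b n) (\<lambda>k r. c (prod_encode (n, prod_encode (k, r)))) (m n))"
proof -
  have *: "rec_nat (Some x) (\<lambda>k r. Option.bind r (\<lambda>i. Some (g k i))) m = Some (rec_nat x g m)"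
    for x :: nat and g m by (induction m) auto
  have "recursive (\<lambda>n. rec_nat (b (fst (prod_decode n)))
      (\<lambda>k r. c (prod_encode (fst (prod_decode n), prod_encode (k, r)))) (snd (prod_decode n)))"
    using pr_prec[OF assms(1,2)[unfolded recursive_def]] unfolding recursive_def * .
  from recursive_comp[OF this recursive_pair[OF recursive_id assms(3)]]
  show ?thesis by simp
qed

text \<open>A recursion that forgets its accumulator and returns the counter ends with the last
  counter, which is the predecessor.\<close>

lemma recursive_pred:
  assumes "recursive f"
  shows "recursive (\<lambda>n. f n - 1)"
proof -
  have "rec_nat 0 (\<lambda>k r. k) m = m - 1" for m :: nat by (cases m) auto
  with recursive_rec_nat[OF recursive_const[of 0] recursive_fst_comp[OF recursive_snd] assms]
  show ?thesis by simp
qed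

lemma recursive_if_zero:
  assumes "recursive t" "recursive f" "recursive g"
  shows "recursive (\<lambda>n. if t n = 0 then f n else g n)"
proof -
  have "rec_nat x (\<lambda>k r. y) m = (if m = 0 then x else y)" for m and x y :: nat by (cases m) auto
  with recursive_rec_nat[OF assms(2) recursive_comp[OF assms(3) recursive_fst] assms(1)]
  show ?thesis by simp
qed

text \<open>The loop state pairs the accumulator with the code of the remaining list, and
  \<open>step\<close> pops one entry. As many rounds as the value of the code suffice: a list is no
  longer than its code, and \<open>step\<close> fixes every state whose list is empty.\<close>

lemma recursive_fold_list:
  assumes "recursive b" "recursive c" "recursive l"
  shows "recursive (\<lambda>n. fold (\<lambda>x acc. c (prod_encode (x, acc))) (list_decode (l n)) (b n))"
proof -
  define step where "step p = (if snd (prod_decode p) = 0 then p else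
     prod_encode (c (prod_encode (fst (prod_decode (snd (prod_decode p) - 1)), fst (prod_decode p))),
                  snd (prod_decode (snd (prod_decode p) - 1))))" for p
  have step: "recursive step"
    unfolding step_def
    by (intro recursive_if_zero recursive_pair recursive_fst_comp recursive_snd_comp recursive_pred
        recursive_id recursive_comp[OF assms(2)])
  have iter: "rec_nat x (\<lambda>k. step) m = (step ^^ m) x" for x m
    by (induction m) auto
  have "fst (prod_decode ((step ^^ m) (prod_encode (acc, list_encode xs)))) =
        fold (\<lambda>x acc. c (prod_encode (x, acc))) xs acc" if "length xs \<le> m" for m acc xs
    using that
  proof (induction m arbitrary: acc xs)
    case 0
    then show ?case by simp
  next
    case (Suc m)
    show ?case
    proof (cases xs)
      case Nil
      have "(step ^^ k) (prod_encode (acc, 0)) = prod_encode (acc, 0)" for k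
        by (induction k) (auto simp: step_def)
      then show ?thesis by (simp add: Nil del: funpow.simps)
    next
      case (Cons y ys)
      then have "step (prod_encode (acc, list_encode xs)) =
          prod_encode (c (prod_encode (y, acc)), list_encode ys)"
        by (simp add: step_def)
      with Suc Cons show ?thesis by (simp add: funpow_Suc_right del: funpow.simps)
    qed
  qed
  moreover have "length xs \<le> list_encode xs" for xs
  proof (induction xs)
    case (Cons x xs)
    then show ?case using le_prod_encode_2[of "list_encode xs" x] by simp
  qed simp
  ultimately have fold: "fst (prod_decode ((step ^^ k) (prod_encode (acc, k)))) =
      fold (\<lambda>x acc. c (prod_encode (x, acc))) (list_decode k) acc" for k acc
    by (metis list_decode_inverse)
  have "recursive (\<lambda>n. fst (prod_decode (rec_nat (prod_encode (b n, l n)) (\<lambda>k. step) (l n))))"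
    using recursive_rec_nat[OF recursive_pair[OF assms(1,3)]
        recursive_comp[OF step recursive_snd_comp[OF recursive_snd]] assms(3)]
    by (intro recursive_fst_comp) simp
  then show ?thesis unfolding iter fold .
qed

section \<open>Computability of the term\<close>

text \<open>Sums over the states are accumulated from the left, so that a single loop over the coded
  state list computes them; \<open>transitions M\<close> is \<open>RM M\<close> up to reordering.\<close>

definition track_letters :: "machine \<Rightarrow> sym dd ktm" where
  "track_letters M = fold (\<lambda>q t. t \<oplus> (vl (St q) \<oplus> vr (St q))) (state_list M)
     (ksum (concat (map (\<lambda>x. [vl x, vr x]) [SymA, SymB, SymC False, SymC True])))"

definition transitions :: "machine \<Rightarrow> sym dd ktm" where
  "transitions M = fold (\<lambda>q t. t \<oplus> instr_term (instr M q) \<odot> vl (St q)) (state_list M) KZero"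

text \<open>What is left of an instruction consists of letters, at most one a-loop and, after it, at
  most one b-loop; the product has room for each of these in turn.\<close>

definition tail_term :: "machine \<Rightarrow> sym dd ktm" where
  "tail_term M = KStar (track_letters M) \<odot> (KStar (vl SymA \<odot> vr SymA) \<odot> (KStar (track_letters M) \<odot>
     (KStar (vl SymB \<odot> vr SymB) \<odot> KStar (track_letters M))))"

lemmas recursive_intros = recursive_pair recursive_fst_comp recursive_snd_comp recursive_pred
  recursive_id recursive_const recursive_if_zero recursive_fst recursive_snd

lemma recursive_instr_term:
  obtains h where "recursive h" "\<And>i. h (instr_code i) = term_code (instr_term i)"
proof -
  let ?fst = "\<lambda>n. fst (prod_decode n)" and ?snd = "\<lambda>n. snd (prod_decode n)"
  \<comment> \<open>The tags are those of \<open>term_code\<close>; \<open>st\<close> nests the tags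
    of \<open>Var\<close>, \<open>Rgt\<close> and \<open>St\<close>.\<close>
  define times where "times a b = prod_encode (4, prod_encode (a, b))" for a b
  define plus where "plus a b = prod_encode (3, prod_encode (a, b))" for a b
  define st where "st q = prod_encode (2, prod_encode (1, prod_encode (0, q)))" for q
  define aa where "aa = term_code (KStar (vl SymA \<odot> vr SymA))"
  define bb where "bb = term_code (KStar (vl SymB \<odot> vr SymB))"
  define va where "va = term_code (vr SymA)"
  define vb where "vb = term_code (vr SymB)"
  define la where "la = term_code (vl SymA)"
  define lb where "lb = term_code (vl SymB)"
  \<comment> \<open>Only zero tests are at hand, so the tag is tested first and then its
    predecessor. The second test is reached for nonzero tags only, where it singles out tag
    1.\<close>
  define h where "h n = (if ?fst n = 0
     then if ?fst (?snd n) = 0 then times (times (times va aa) bb) (st (?snd (?snd n)))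
       else times (times (times aa vb) bb) (st (?snd (?snd n)))
     else if ?fst n - 1 = 0
     then if ?fst (?snd n) = 0
       then plus (times bb (st (?fst (?snd (?snd n)))))
          (times (times (times la aa) bb) (st (?snd (?snd (?snd n)))))
       else plus (times aa (st (?fst (?snd (?snd n)))))
          (times (times (times aa lb) bb) (st (?snd (?snd (?snd n)))))
     else prod_encode (2, prod_encode (1, prod_encode (3, ?snd n))))" for n
  have "recursive h"
    unfolding h_def times_def plus_def st_def by (intro recursive_intros)
  moreover have "h (instr_code i) = term_code (instr_term i)" for i
    by (cases i rule: instr_term.cases)
      (simp_all add: h_def times_def plus_def st_def aa_def bb_def va_def vb_def la_def lb_def)
  ultimately show thesis using that by blast
qed

lemma recursive_tail_term:
  obtains f where "recursive f" "\<And>M w. f (input_code M w) = term_code (tail_term M \<odot> KStar (transitions M))"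
proof -
  obtain h where h: "recursive h" "\<And>i. h (instr_code i) = term_code (instr_term i)"
    using recursive_instr_term by blast
  let ?fst = "\<lambda>n. fst (prod_decode n)" and ?snd = "\<lambda>n. snd (prod_decode n)"
  define times where "times a b = prod_encode (4, prod_encode (a, b))" for a b
  define plus where "plus a b = prod_encode (3, prod_encode (a, b))" for a b
  define star where "star a = prod_encode (5, a)" for a
  define st where "st k q = prod_encode (2, prod_encode (k, prod_encode (0, q)))" for k q
  define aa where "aa = term_code (KStar (vl SymA \<odot> vr SymA))"
  define bb where "bb = term_code (KStar (vl SymB \<odot> vr SymB))"
  define z0 where "z0 = term_code (ksum (concat (map (\<lambda>x. [vl x, vr x]) [SymA, SymB, SymC False, SymC True])))"
  define zstep where "zstep p = plus (?snd p) (plus (st 0 (?fst (?fst p))) (st 1 (?fst (?fst p))))" for p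
  define rstep where "rstep p = plus (?snd p) (times (h (?snd (?fst p))) (st 0 (?fst (?fst p))))" for p
  \<comment> \<open>\<open>?snd (?fst n)\<close> is the coded state list of the machine; its entries
    pair a state with its instruction code, to which \<open>rstep\<close> applies
    \<open>h\<close>.\<close>
  define z where "z n = star (fold (\<lambda>x acc. zstep (prod_encode (x, acc))) (list_decode (?snd (?fst n))) z0)" for n
  define r where "r n = star (fold (\<lambda>x acc. rstep (prod_encode (x, acc))) (list_decode (?snd (?fst n)))
     (term_code KZero))" for n
  define f where "f n = times (times (z n) (times aa (times (z n) (times bb (z n))))) (r n)" for n
  have zr: "recursive z" unfolding z_def star_def
    by (intro recursive_pair recursive_const recursive_fold_list, unfold zstep_def plus_def st_def)
      (intro recursive_intros)+
  have rr: "recursive r" unfolding r_def star_def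
    by (intro recursive_pair recursive_const recursive_fold_list, unfold rstep_def plus_def times_def st_def)
      (intro recursive_intros recursive_comp[OF h(1)])+
  have "recursive f"
    unfolding f_def times_def by (intro recursive_intros zr rr)
  moreover have "f (input_code M w) = term_code (tail_term M \<odot> KStar (transitions M))" for M w
  proof -
    let ?l = "map (\<lambda>q. prod_encode (q, instr_code (instr M q)))"
    have "fold (\<lambda>x acc. zstep (prod_encode (x, acc))) (?l qs) (term_code t) =
      term_code (fold (\<lambda>q t. t \<oplus> (vl (St q) \<oplus> vr (St q))) qs t)" for qs t
    proof (induction qs arbitrary: t)
      case (Cons q qs)
      have "zstep (prod_encode (prod_encode (q, instr_code (instr M q)), term_code t)) =
        term_code (t \<oplus> (vl (St q) \<oplus> vr (St q)))"
        by (simp add: zstep_def plus_def st_def)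
      then show ?case using Cons by (simp del: term_code.simps)
    qed simp
    then have z: "z (input_code M w) = term_code (KStar (track_letters M))"
      by (simp add: z_def input_code_def machine_code_def z0_def track_letters_def star_def
          del: term_code.simps(1-5))
    have "fold (\<lambda>x acc. rstep (prod_encode (x, acc))) (?l qs) (term_code t) =
      term_code (fold (\<lambda>q t. t \<oplus> instr_term (instr M q) \<odot> vl (St q)) qs t)" for qs t
    proof (induction qs arbitrary: t)
      case (Cons q qs)
      have "rstep (prod_encode (prod_encode (q, instr_code (instr M q)), term_code t)) =
        term_code (t \<oplus> instr_term (instr M q) \<odot> vl (St q))"
        by (simp add: rstep_def plus_def times_def st_def h)
      then show ?case using Cons by (simp del: term_code.simps)
    qed simp
    then have r: "r (input_code M w) = term_code (KStar (transitions M))"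
      by (simp add: r_def input_code_def machine_code_def transitions_def star_def
          del: term_code.simps(1-5))
    show ?thesis
      by (simp add: f_def times_def z r tail_term_def aa_def bb_def)
  qed
  ultimately show thesis using that by blast
qed

section \<open>The two-track algebra over all symbols\<close>

lemma ksubst_Var [simp]: "ksubst Var t = t"
  by (induction t) auto

lemma ksubst_in_terms:
  assumes "t \<in> terms Y" "\<And>x. x \<in> carr Y \<Longrightarrow> h x \<in> terms Z"
  shows "ksubst h t \<in> terms Z"
  using assms(1) by (induction t) (use assms(2) in \<open>auto simp: terms_def\<close>)

text \<open>Universal property of the free algebra: substitution maps every axiom to an instance of
  itself, except \<open>var_comm\<close>, for which the images of commuting letters have to
  commute.\<close>

lemma pka_eq_ksubst:
  assumes "pka_eq Y t u"
    and in_terms: "\<And>x. x \<in> carr Y \<Longrightarrow> h x \<in> terms Z"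
    and commute: "\<And>x y. x \<in> carr Y \<Longrightarrow> y \<in> carr Y \<Longrightarrow> comm Y x y \<Longrightarrow>
      pka_eq Z (h x \<odot> h y) (h y \<odot> h x)"
  shows "pka_eq Z (ksubst h t) (ksubst h u)"
  using assms(1)
proof (induction rule: pka_eq.induct)
  case (eq_sym t u)
  from eq_sym.IH show ?case by (rule pka_eq.eq_sym)
next
  case (eq_trans t u v)
  then show ?case by (blast intro: pka_eq.eq_trans)
next
  case (var_comm x y)
  then show ?case by (simp add: commute)
qed (simp_all add: ksubst_in_terms[OF _ in_terms] pka_eq.eq_refl cong_plus cong_times cong_star
  plus_assoc plus_comm plus_zero plus_idem times_assoc one_times times_one distrib_left
  distrib_right zero_times times_zero star_unfold)

text \<open>A fixed alphabet makes the algebra a single type in which every term is well formed;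
  \<open>pka_eq_full\<close> and \<open>pka_eq_restrict\<close> lead from the alphabet of a machine
  to it and back.\<close>

abbreviation full :: "'a dd comset" where
  "full \<equiv> ddot (discrete_comset UNIV)"

lemma carr_full [simp]: "carr full = UNIV"
  unfolding ddot_def discrete_comset_def by (auto, metis dd.exhaust rangeI)

lemma terms_full [simp]: "terms full = UNIV"
  by (auto simp: terms_def)

lemma comm_full: "comm full x y \<longleftrightarrow> comm (ddot (discrete_comset X)) x y"
  by (simp add: ddot_def discrete_comset_def)

lemma pka_eq_full:
  assumes "pka_eq (ddot (discrete_comset X)) t u"
  shows "pka_eq full t u"
proof -
  have "pka_eq full (ksubst Var t) (ksubst Var u)"
    using assms
  proof (rule pka_eq_ksubst)
    fix x y assume "comm (ddot (discrete_comset X)) x y"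
    then show "pka_eq full (Var x \<odot> Var y) (Var y \<odot> Var x)"
      using comm_full by (intro var_comm) auto
  qed simp
  then show ?thesis by simp
qed

text \<open>Substituting \<open>0\<close> for the symbols outside \<open>X\<close> retracts the algebra over all symbols onto the
  one over \<open>X\<close>.\<close>

lemma pka_eq_restrict:
  assumes "pka_eq full t u"
    and t: "(t :: 'a dd ktm) \<in> terms (ddot (discrete_comset X))" and u: "u \<in> terms (ddot (discrete_comset X))"
  shows "pka_eq (ddot (discrete_comset X)) t u"
proof -
  let ?Y = "ddot (discrete_comset X)"
  let ?h = "\<lambda>x. if x \<in> carr ?Y then Var x else KZero"
  have id: "ksubst ?h v = v" if "v \<in> terms ?Y" for v
    using that by (induction v) (auto simp: terms_def)
  have zero: "KZero \<in> terms ?Y" by (simp add: terms_def)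
  have "pka_eq ?Y (ksubst ?h t) (ksubst ?h u)"
    using assms(1)
  proof (rule pka_eq_ksubst)
    fix x :: "'a dd"
    show "?h x \<in> terms ?Y" by (simp add: terms_def)
  next
    fix x y :: "'a dd" assume c: "comm full x y"
    \<comment> \<open>Letters outside \<open>X\<close> become 0, which commutes with everything by
      absorption, so the retraction respects \<open>var_comm\<close>.\<close>
    have z: "pka_eq ?Y (v \<odot> KZero) (KZero \<odot> v)" if "v \<in> terms ?Y" for v
      using that by (blast intro: eq_trans eq_sym zero_times times_zero)
    show "pka_eq ?Y (?h x \<odot> ?h y) (?h y \<odot> ?h x)"
      using c z[of "Var x"] z[of "Var y", THEN eq_sym] z[OF zero]
      by (auto simp: comm_full[of _ _ X] terms_def intro: var_comm)
  qed
  then show ?thesis by (simp add: id t u)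
qed

\<comment> \<open>The free algebra as an ordered semiring\<close>
quotient_type 'a tracks = "'a dd ktm" / "pka_eq full"
proof (intro equivpI reflpI sympI transpI)
  show "pka_eq full t t" for t :: "'a dd ktm" by (rule eq_refl) simp
qed (blast intro: eq_sym eq_trans)+

lift_definition kstar :: "'a tracks \<Rightarrow> 'a tracks" is KStar by (rule cong_star)

instantiation tracks :: (type) "{semiring_0, monoid_mult, order}"
begin

lift_definition zero_tracks :: "'a tracks" is KZero .
lift_definition one_tracks :: "'a tracks" is KOne .
lift_definition plus_tracks :: "'a tracks \<Rightarrow> 'a tracks \<Rightarrow> 'a tracks" is KPlus by (rule cong_plus)
lift_definition times_tracks :: "'a tracks \<Rightarrow> 'a tracks \<Rightarrow> 'a tracks" is KTimes by (rule cong_times)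
definition less_eq_tracks :: "'a tracks \<Rightarrow> 'a tracks \<Rightarrow> bool" where
  "less_eq_tracks x y \<longleftrightarrow> x + y = y"
definition less_tracks :: "'a tracks \<Rightarrow> 'a tracks \<Rightarrow> bool" where
  "less_tracks x y \<longleftrightarrow> x \<le> y \<and> x \<noteq> y"

instance
proof
  fix a b c :: "'a tracks"
  show assoc: "a + b + c = a + (b + c)" for a b c :: "'a tracks"
    by transfer (simp add: plus_assoc)
  show comm: "a + b = b + a" for a b :: "'a tracks" by transfer (simp add: plus_comm)
  have idem: "a + a = a" for a :: "'a tracks" by transfer (simp add: plus_idem)
  show "0 + a = a" by (subst comm, transfer) (simp add: plus_zero)
  show "a * b * c = a * (b * c)" by transfer (simp add: times_assoc)
  show "1 * a = a" "a * 1 = a" "0 * a = 0" "a * 0 = 0"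
    by (transfer; simp add: one_times times_one zero_times times_zero)+
  show "(a + b) * c = a * c + b * c" "a * (b + c) = a * b + a * c"
    by (transfer; simp add: distrib_left distrib_right)+
  show "a \<le> a" by (simp add: less_eq_tracks_def idem)
  show "a \<le> b \<Longrightarrow> b \<le> c \<Longrightarrow> a \<le> c" unfolding less_eq_tracks_def by (metis assoc)
  show "a \<le> b \<Longrightarrow> b \<le> a \<Longrightarrow> a = b" unfolding less_eq_tracks_def by (metis comm)
  then show "a < b \<longleftrightarrow> a \<le> b \<and> \<not> b \<le> a"
    unfolding less_tracks_def using \<open>a \<le> a\<close> by blast
qed

end

lemma tracks_add_idem [simp]: "x + x = (x :: 'a tracks)"
  using order_refl[of x] unfolding less_eq_tracks_def .

instance tracks :: (type) ordered_comm_monoid_add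
proof
  fix a b c :: "'a tracks"
  assume "a \<le> b"
  then show "c + a \<le> c + b"
    unfolding less_eq_tracks_def by (metis add.assoc add.commute tracks_add_idem)
qed

lemma tracks_zero_le [simp]: "0 \<le> (x :: 'a tracks)"
  by (simp add: less_eq_tracks_def)

lemma tracks_le_add1: "x \<le> x + (y :: 'a tracks)" and tracks_le_add2: "y \<le> x + (y :: 'a tracks)"
  using add_mono[of x x 0 y] add_mono[of 0 x y y] by simp_all

lemma tracks_add_le_iff [simp]: "x + y \<le> z \<longleftrightarrow> x \<le> z \<and> y \<le> (z :: 'a tracks)"
proof
  assume "x + y \<le> z"
  then show "x \<le> z \<and> y \<le> z" using tracks_le_add1 tracks_le_add2 order_trans by blast
next
  assume "x \<le> z \<and> y \<le> z"
  then show "x + y \<le> z" using add_mono[of x z y z] by simp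
qed

lemmas tracks_distribs = semiring_class.distrib_left semiring_class.distrib_right

lemma tracks_mult_mono: "x \<le> x' \<Longrightarrow> y \<le> y' \<Longrightarrow> x * y \<le> x' * (y' :: 'a tracks)"
proof -
  assume "x \<le> x'" "y \<le> y'"
  then have "x' * y' = x * y + (x * y' + (x' * y + x' * y'))"
    unfolding less_eq_tracks_def by (metis add.assoc tracks_distribs)
  then show "x * y \<le> x' * y'" using tracks_le_add1 by metis
qed

lemma kstar_unfold: "kstar x = 1 + x * kstar x"
  by transfer (rule star_unfold, simp)

lemma one_le_kstar: "1 \<le> kstar x"
  by (subst kstar_unfold) (rule tracks_le_add1)

text \<open>x y^* \<le> y y^* \<le> 1 + y y^* = y^*, with a single unfolding.\<close>

lemma mult_kstar_le: "x \<le> y \<Longrightarrow> x * kstar y \<le> kstar y"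
  by (subst (2) kstar_unfold) (metis order_trans order_refl tracks_le_add2 tracks_mult_mono)

section \<open>Words on the two tracks and the laws of the queue\<close>

lift_definition lt :: "'a \<Rightarrow> 'a tracks" is "\<lambda>x. vl x" .
lift_definition rt :: "'a \<Rightarrow> 'a tracks" is "\<lambda>x. vr x" .

lemma rt_lt_commute: "rt y * lt x = lt x * rt y"
proof (transfer, rule var_comm)
  show "Rgt y \<in> carr full" "Lft x \<in> carr full" for x y :: 'a
    by (auto simp: ddot_def discrete_comset_def)
qed (simp add: ddot_def)

abbreviation bt :: "'a \<Rightarrow> 'a tracks" where "bt x \<equiv> lt x * rt x"

definition rword :: "'a list \<Rightarrow> 'a tracks" where "rword w = prod_list (map rt w)"
definition lword :: "'a list \<Rightarrow> 'a tracks" where "lword w = prod_list (map lt w)"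
definition bword :: "'a list \<Rightarrow> 'a tracks" where "bword w = prod_list (map bt w)"

lemma word_simps [simp]:
  "rword [] = 1" "rword (x # u) = rt x * rword u" "rword (u @ v) = rword u * rword v"
  "lword [] = 1" "lword (x # u) = lt x * lword u"
  "bword [] = 1" "bword (x # u) = bt x * bword u" "bword (u @ v) = bword u * bword v"
  by (simp_all add: rword_def lword_def bword_def)

lemma rword_lt_commute: "rword w * lt x = lt x * rword w"
proof (induction w)
  case (Cons y w)
  then have "rt y * (rword w * lt x) = lt x * rt y * rword w"
    by (simp add: rt_lt_commute mult.assoc[symmetric])
  then show ?case by (simp add: mult.assoc)
qed simp

text \<open>Each left letter moves left across the rest of the right word until it meets its own
  partner.\<close>

lemma rword_lword: "rword w * lword w = bword w"
proof (induction w)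
  case (Cons x w)
  have "rt x * rword w * (lt x * lword w) = rt x * (rword w * lt x) * lword w"
    by (simp add: mult.assoc)
  also have "\<dots> = rt x * lt x * (rword w * lword w)"
    by (simp add: mult.assoc rword_lt_commute)
  finally show ?case using Cons by (simp add: rt_lt_commute)
qed simp

text \<open>Dequeuing: the left letter crosses the whole word and meets its front. The next law is
  enqueuing.\<close>

lemma rword_lt_mult: "rword (y # s) * (lt x * F) = lt x * rt y * (rword s * F)"
proof -
  have "rword (y # s) * (lt x * F) = rword (y # s) * lt x * F" by (simp only: mult.assoc)
  then show ?thesis by (simp only: rword_lt_commute) (simp add: mult.assoc)
qed

lemma rword_rt_mult: "rword s * (rt y * F) = rword (s @ [y]) * F"
  by (simp add: mult.assoc)

text \<open>One unfolding of a loop: either it is left at once, or x is dequeued, x is enqueued and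
  the loop goes on.\<close>

lemma rword_kstar_bt:
  "rword s * (kstar (bt x) * F) =
   rword s * F + rword s * (lt x * (rt x * (kstar (bt x) * F)))"
  by (subst kstar_unfold) (simp add: tracks_distribs mult.assoc)

section \<open>From terms to the quotient and back\<close>

definition denot :: "'a dd ktm \<Rightarrow> 'a tracks" where "denot = abs_tracks"

lemma denot_simps [simp]:
  "denot KZero = 0" "denot KOne = 1" "denot (t \<oplus> u) = denot t + denot u"
  "denot (t \<odot> u) = denot t * denot u" "denot (KStar t) = kstar (denot t)"
  "denot (vl x) = lt x" "denot (vr x) = rt x"
  by (simp_all add: denot_def zero_tracks.abs_eq one_tracks.abs_eq plus_tracks.abs_eq
      times_tracks.abs_eq kstar.abs_eq lt.abs_eq rt.abs_eq)

lemma denot_eq_iff: "denot t = denot u \<longleftrightarrow> pka_eq full t u"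
  unfolding denot_def by (rule tracks.abs_eq_iff)

lemma denot_ksum: "denot (ksum ts) = sum_list (map denot ts)"
  by (induction ts) (auto simp: ksum_def)

lemma denot_le_if_pka_le:
  "pka_le (ddot (discrete_comset X)) t u \<Longrightarrow> denot t \<le> denot u"
  unfolding pka_le_def less_eq_tracks_def denot_simps(3)[symmetric] denot_eq_iff by (rule pka_eq_full)

text \<open>Conservativity: the retraction \<open>pka_eq_restrict\<close> turns an inequality over
  all symbols into a derivation over \<open>X\<close>.\<close>

lemma pka_le_if_denot_le:
  assumes "denot t \<le> denot u"
    and "t \<in> terms (ddot (discrete_comset X))" "u \<in> terms (ddot (discrete_comset X))"
  shows "pka_le (ddot (discrete_comset X)) t u"
proof -
  have "pka_eq full (t \<oplus> u) u"
    using assms(1) unfolding less_eq_tracks_def denot_eq_iff[symmetric] by simp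
  then show ?thesis
    unfolding pka_le_def by (rule pka_eq_restrict) (use assms in \<open>auto simp: terms_def\<close>)
qed

lemma denot_words [simp]:
  "denot (lterm (str_term w)) = lword w" "denot (rterm (str_term w)) = rword w"
  by (induction w) (auto simp: lterm_def rterm_def str_term_def)

text \<open>Renaming to the right track preserves commutation, as in a discrete alphabet a letter
  commutes only with itself.\<close>

lemma pka_le_rterm:
  assumes "pka_le (discrete_comset X) t u"
  shows "denot (rterm t) \<le> denot (rterm u)"
proof -
  have "pka_eq (ddot (discrete_comset X)) (rterm (t \<oplus> u)) (rterm u)"
    unfolding rterm_def
    by (rule pka_eq_ksubst[OF assms[unfolded pka_le_def]])
      (auto simp: terms_def ddot_def discrete_comset_def intro: eq_refl)
  then show ?thesis
    by (intro denot_le_if_pka_le) (simp add: pka_le_def rterm_def)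
qed

section \<open>The model of binary relations on words\<close>

inductive_set iter :: "('a list \<times> 'a list) set \<Rightarrow> ('a list \<times> 'a list) set" for A where
  "([], []) \<in> iter A"
| "(u, v) \<in> A \<Longrightarrow> (u', v') \<in> iter A \<Longrightarrow> (u @ u', v @ v') \<in> iter A"

definition cat :: "('a list \<times> 'a list) set \<Rightarrow> ('a list \<times> 'a list) set \<Rightarrow> ('a list \<times> 'a list) set" where
  "cat A B = {(u @ u', v @ v') | u v u' v'. (u, v) \<in> A \<and> (u', v') \<in> B}"

text \<open>Terms become relations between a left word and a right word, multiplied by componentwise
  concatenation. The model serves to refute inequalities.\<close>

primrec rel :: "'a dd ktm \<Rightarrow> ('a list \<times> 'a list) set" where
  "rel KZero = {}"
| "rel KOne = {([], [])}"
| "rel (Var x) = {case x of Lft y \<Rightarrow> ([y], []) | Rgt y \<Rightarrow> ([], [y])}"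
| "rel (t \<oplus> u) = rel t \<union> rel u"
| "rel (t \<odot> u) = cat (rel t) (rel u)"
| "rel (KStar t) = iter (rel t)"

lemma catI: "(u, v) \<in> A \<Longrightarrow> (u', v') \<in> B \<Longrightarrow> (u @ u', v @ v') \<in> cat A B"
  unfolding cat_def by blast

lemma catE:
  assumes "p \<in> cat A B"
  obtains u v u' v' where "p = (u @ u', v @ v')" "(u, v) \<in> A" "(u', v') \<in> B"
  using assms unfolding cat_def by blast

lemma cat_assoc: "cat (cat A B) C = cat A (cat B C)"
proof
  show "cat (cat A B) C \<subseteq> cat A (cat B C)"
  proof
    fix p assume "p \<in> cat (cat A B) C"
    then obtain u v u' v' u'' v'' where "p = (u @ u' @ u'', v @ v' @ v'')"
      and "(u, v) \<in> A" "(u', v') \<in> B" "(u'', v'') \<in> C" by (auto elim!: catE)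
    then show "p \<in> cat A (cat B C)" by (auto intro: catI)
  qed
  show "cat A (cat B C) \<subseteq> cat (cat A B) C"
  proof
    fix p assume "p \<in> cat A (cat B C)"
    then obtain u v u' v' u'' v'' where "p = (u @ u' @ u'', v @ v' @ v'')"
      and "(u, v) \<in> A" "(u', v') \<in> B" "(u'', v'') \<in> C" by (auto elim!: catE)
    then show "p \<in> cat (cat A B) C"
      using catI[OF catI] by (metis append_assoc)
  qed
qed

lemma iter_unfold: "iter A = {([], [])} \<union> cat A (iter A)"
proof
  show "iter A \<subseteq> {([], [])} \<union> cat A (iter A)"
  proof clarify
    fix u v assume "(u, v) \<in> iter A" "(u, v) \<notin> cat A (iter A)"
    then show "u = [] \<and> v = []" by cases (auto intro: catI)
  qed
  show "{([], [])} \<union> cat A (iter A) \<subseteq> iter A"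
    by (auto elim!: catE intro: iter.intros)
qed

lemma cat_simps [simp]:
  "cat {} A = {}" "cat A {} = {}" "cat {([], [])} A = A" "cat A {([], [])} = A"
  "cat (A \<union> B) C = cat A C \<union> cat B C" "cat A (B \<union> C) = cat A B \<union> cat A C"
  by (simp_all add: cat_def) blast+

text \<open>Soundness of the model: the star axiom is \<open>iter_unfold\<close>, and letters of
  opposite tracks commute because they are written in different components.\<close>

lemma rel_eq_if_pka_eq:
  assumes "pka_eq full t u"
  shows "rel t = rel u"
  using assms
proof (induction rule: pka_eq.induct)
  case (times_assoc t u v)
  show ?case by (simp add: cat_assoc)
next
  case (star_unfold t)
  show ?case using iter_unfold by simp
next
  case (var_comm x y)
  then show ?case by (cases x; cases y) (auto simp: cat_def ddot_def discrete_comset_def)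
qed (simp_all add: Un_ac)

lift_definition trel :: "'a tracks \<Rightarrow> ('a list \<times> 'a list) set" is rel
  by (rule rel_eq_if_pka_eq)

lemma trel_simps [simp]:
  "trel 0 = {}" "trel 1 = {([], [])}" "trel (x + y) = trel x \<union> trel y"
  "trel (x * y) = cat (trel x) (trel y)" "trel (kstar x) = iter (trel x)"
  "trel (lt a) = {([a], [])}" "trel (rt a) = {([], [a])}"
  by (transfer; simp)+

lemma trel_mono: "x \<le> y \<Longrightarrow> trel x \<subseteq> trel y"
  unfolding less_eq_tracks_def by (metis sup.orderI sup_commute trel_simps(3))

lemma trel_sum_list: "trel (sum_list xs) = (\<Union>x\<in>set xs. trel x)"
  by (induction xs) auto

lemma trel_words [simp]:
  "trel (rword w) = {([], w)}" "trel (lword w) = {(w, [])}" "trel (bword w) = {(w, w)}"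
  by (induction w) (simp_all, simp_all add: cat_def)

section \<open>The bound and its mismatch part\<close>

definition symbols :: "machine \<Rightarrow> sym set" where
  "symbols M = St ` states M \<union> {SymA, SymB, SymC False, SymC True}"

lemma Sig_eq: "Sig M = discrete_comset (symbols M)"
  by (simp add: Sig_def symbols_def)

lemma carr_Sig [simp]: "carr (Sig M) = symbols M"
  by (simp add: Sig_eq discrete_comset_def)

lemma symbols_simps [simp]:
  "St q \<in> symbols M \<longleftrightarrow> q \<in> states M" "SymA \<in> symbols M" "SymB \<in> symbols M" "SymC x \<in> symbols M"
  by (cases x; auto simp: symbols_def)+

text \<open>\<open>Z0\<close>, \<open>Z1\<close> and \<open>Z2\<close> are suffixes of
  \<open>tail_term\<close>: they bound remainders with no loop, with the b-loop, and with both loops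
  still to run.\<close>

definition Z0 :: "machine \<Rightarrow> sym tracks" where
  "Z0 M = kstar (denot (track_letters M))"

definition Z1 :: "machine \<Rightarrow> sym tracks" where
  "Z1 M = Z0 M * (kstar (bt SymB) * Z0 M)"

definition Z2 :: "machine \<Rightarrow> sym tracks" where
  "Z2 M = Z0 M * (kstar (bt SymA) * Z1 M)"

text \<open>The second summand of the target without its final star of R, so that it bounds the
  failures of a single R.\<close>

definition mismatch :: "machine \<Rightarrow> sym tracks" where
  "mismatch M = denot (Sig_star M) * denot (Sig_neq M) * Z2 M"

lemma denot_tail_term: "denot (tail_term M) = Z2 M"
  by (simp add: tail_term_def Z0_def Z1_def Z2_def)

lemma denot_fold: "denot (fold (\<lambda>q t. t \<oplus> f q) qs t) = denot t + sum_list (map (\<lambda>q. denot (f q)) qs)"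
  by (induction qs arbitrary: t) (auto simp: add.assoc)

lemma tracks_le_sum_list: "x \<in> set xs \<Longrightarrow> x \<le> sum_list (xs :: 'a tracks list)"
  by (induction xs) (auto intro: tracks_le_add1 tracks_le_add2 order_trans)

lemma tracks_sum_list_le: "(\<And>x. x \<in> set xs \<Longrightarrow> x \<le> y) \<Longrightarrow> sum_list (xs :: 'a tracks list) \<le> y"
  by (induction xs) auto

lemma denot_transitions: "denot (transitions M) = denot (RM M)"
  by (simp add: transitions_def RM_def denot_fold denot_ksum comp_def)

lemma set_state_list [simp]: "finite (states M) \<Longrightarrow> set (state_list M) = states M"
  by (simp add: state_list_def)

lemma le_track_letters:
  assumes "finite (states M)" "x \<in> symbols M"
  shows "lt x \<le> denot (track_letters M)" "rt x \<le> denot (track_letters M)"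
proof -
  let ?base = "concat (map (\<lambda>x. [vl x, vr x]) [SymA, SymB, SymC False, SymC True])"
  let ?states = "sum_list (map (\<lambda>q. lt (St q) + rt (St q)) (state_list M))"
  have eq: "denot (track_letters M) = sum_list (map denot ?base) + ?states"
    by (simp only: track_letters_def denot_fold denot_ksum denot_simps)
  consider q where "x = St q" "q \<in> states M" | "lt x \<in> set (map denot ?base)" "rt x \<in> set (map denot ?base)"
    using assms(2) by (auto simp: symbols_def)
  then have "lt x \<le> denot (track_letters M) \<and> rt x \<le> denot (track_letters M)"
  proof cases
    case 1
    then have "lt x + rt x \<le> ?states"
      using assms(1) by (intro tracks_le_sum_list) auto
    then show ?thesis unfolding eq by (auto intro: order_trans tracks_le_add2)
  next
    case 2
    then show ?thesis unfolding eq by (meson order_trans tracks_le_add1 tracks_le_sum_list)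
  qed
  then show "lt x \<le> denot (track_letters M)" "rt x \<le> denot (track_letters M)" by auto
qed

text \<open>x z \<le> x (y u) = (x y) u \<le> y u. In this way the leading factor \<open>Z0\<close>
  of \<open>Z1\<close> and \<open>Z2\<close> swallows letters.\<close>

lemma tracks_mult_le_left: "x * y \<le> y \<Longrightarrow> z \<le> y * u \<Longrightarrow> x * z \<le> (y * u :: 'a tracks)"
  using tracks_mult_mono[of "x * y" y u u] tracks_mult_mono[of x x z "y * u"]
  by (auto simp: mult.assoc)

lemma tracks_le_one_mult: "1 \<le> x \<Longrightarrow> y \<le> z \<Longrightarrow> y \<le> (x * z :: 'a tracks)"
  using tracks_mult_mono[of 1 x y z] by simp

section \<open>Configurations, successors and the target bound\<close>

definition conf :: "nat \<Rightarrow> nat \<Rightarrow> nat \<Rightarrow> sym list" where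
  "conf i j q = replicate i SymA @ replicate j SymB @ [St q]"

definition confs :: "machine \<Rightarrow> sym list set" where
  "confs M = {conf i j q | i j q. q \<in> states M}"

text \<open>The value 0 stands for a missing successor, which occurs at a halting state with a
  nonzero counter.\<close>

definition succ_elem :: "machine \<Rightarrow> sym tracks \<Rightarrow> bool" where
  "succ_elem M N \<longleftrightarrow> N = 0 \<or> (\<exists>w \<in> confs M \<union> range (\<lambda>x. [SymC x]). N = rword w)"

definition bound :: "machine \<Rightarrow> sym tracks" where
  "bound M = denot (Sig_star M) * denot (rterm (CM M \<oplus> Var (SymC True))) + mismatch M * kstar (denot (RM M))"

context
  fixes M :: machine
  assumes finite_states: "finite (states M)"
begin

section \<open>Absorption of letters and words\<close>

lemma letter_mult_Z0:
  assumes "x \<in> symbols M"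
  shows "lt x * Z0 M \<le> Z0 M" "rt x * Z0 M \<le> Z0 M"
  unfolding Z0_def by (intro mult_kstar_le le_track_letters finite_states assms)+

lemma one_le_Z0: "1 \<le> Z0 M"
  unfolding Z0_def by (rule one_le_kstar)

lemma letter_mult_Z0_le:
  assumes "x \<in> symbols M" "F \<le> Z0 M"
  shows "lt x * F \<le> Z0 M" "rt x * F \<le> Z0 M"
  using letter_mult_Z0[OF assms(1)] assms(2) by (meson order_refl order_trans tracks_mult_mono)+

lemma letter_mult_Z1_le:
  assumes "x \<in> symbols M" "F \<le> Z1 M"
  shows "lt x * F \<le> Z1 M" "rt x * F \<le> Z1 M"
  using letter_mult_Z0[OF assms(1)] assms(2) unfolding Z1_def by (auto intro: tracks_mult_le_left)

lemma letter_mult_Z2_le: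
  assumes "x \<in> symbols M" "F \<le> Z2 M"
  shows "lt x * F \<le> Z2 M" "rt x * F \<le> Z2 M"
  using letter_mult_Z0[OF assms(1)] assms(2) unfolding Z2_def by (auto intro: tracks_mult_le_left)

lemma kstar_b_le_Z1: "F \<le> Z0 M \<Longrightarrow> kstar (bt SymB) * F \<le> Z1 M"
  unfolding Z1_def by (intro tracks_le_one_mult one_le_Z0 tracks_mult_mono order_refl)

lemma kstar_a_le_Z2: "F \<le> Z1 M \<Longrightarrow> kstar (bt SymA) * F \<le> Z2 M"
  unfolding Z2_def by (intro tracks_le_one_mult one_le_Z0 tracks_mult_mono order_refl)

lemma Z0_le_Z1: "F \<le> Z0 M \<Longrightarrow> F \<le> Z1 M"
  using tracks_le_one_mult[OF one_le_Z0 tracks_le_one_mult[OF one_le_kstar]] unfolding Z1_def .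

lemma Z1_le_Z2: "F \<le> Z1 M \<Longrightarrow> F \<le> Z2 M"
  using tracks_le_one_mult[OF one_le_Z0 tracks_le_one_mult[OF one_le_kstar]] unfolding Z2_def .

lemma rword_mult_Z2_le: "s \<in> lists (symbols M) \<Longrightarrow> F \<le> Z2 M \<Longrightarrow> rword s * F \<le> Z2 M"
  by (induction s) (auto simp: mult.assoc intro: letter_mult_Z2_le)

lemma denot_Sig_star: "denot (Sig_star M) = kstar (sum_list (map bt (sym_list M)))"
proof -
  have "denot (bterm (ksum (map Var xs))) = sum_list (map bt xs)" for xs :: "sym list"
    by (induction xs) (auto simp: ksum_def bterm_def)
  then show ?thesis by (simp add: Sig_star_def bterm_def)
qed

lemma bword_mult_Sig_star:
  "w \<in> lists (symbols M) \<Longrightarrow> bword w * denot (Sig_star M) \<le> denot (Sig_star M)"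
proof (induction w)
  case (Cons x w)
  then have "bt x \<le> sum_list (map bt (sym_list M))"
    by (intro tracks_le_sum_list) (use set_sym_list[OF finite_states] in auto)
  then have "bt x * denot (Sig_star M) \<le> denot (Sig_star M)"
    unfolding denot_Sig_star by (rule mult_kstar_le)
  moreover have "bword (x # w) * denot (Sig_star M) \<le> bt x * denot (Sig_star M)"
    using tracks_mult_mono[OF order_refl[of "bt x"]] Cons by (simp only: word_simps mult.assoc) simp
  ultimately show ?case by (rule order_trans[rotated])
qed simp

lemma bword_mult_Sig_star_mult:
  "w \<in> lists (symbols M) \<Longrightarrow> bword w * (denot (Sig_star M) * F) \<le> denot (Sig_star M) * F"
  unfolding mult.assoc[symmetric] by (rule tracks_mult_mono[OF bword_mult_Sig_star order_refl])

text \<open>A matched prefix vanishes into the leading \<open>Sig_star\<close>, so it does not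
  matter how much has been read before letters differ.\<close>

lemma bword_mult_mismatch: "w \<in> lists (symbols M) \<Longrightarrow> bword w * mismatch M \<le> mismatch M"
  using bword_mult_Sig_star_mult unfolding mismatch_def by (simp add: mult.assoc)

section \<open>Reading configurations from a queue\<close>

text \<open>The left letter and the front of the queue form a summand of \<open>Sig_neq\<close>,
  \<open>Z2\<close> absorbs the rest of the queue in front of F, and \<open>Sig_star\<close> is at
  least 1.\<close>

lemma pop_mismatch:
  assumes "x \<in> symbols M" "y # s \<in> lists (symbols M)" "x \<noteq> y" "F \<le> Z2 M"
  shows "rword (y # s) * (lt x * F) \<le> mismatch M"
proof -
  have "lt x * rt y \<le> denot (Sig_neq M)"
  proof -
    have "x \<in> set (sym_list M)" "y \<in> set (sym_list M)"
      using assms(1,2) set_sym_list[OF finite_states] by auto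
    then have "vl x \<odot> vr y \<in> set [vl x \<odot> vr y. x \<leftarrow> sym_list M, y \<leftarrow> sym_list M, x \<noteq> y]"
      using assms(3) by auto
    from imageI[OF this, of denot] show ?thesis
      unfolding Sig_neq_def denot_ksum by (intro tracks_le_sum_list) simp
  qed
  moreover have "rword s * F \<le> Z2 M" using assms by (auto intro: rword_mult_Z2_le)
  ultimately have "lt x * rt y * (rword s * F) \<le> denot (Sig_neq M) * Z2 M" by (rule tracks_mult_mono)
  then have "lt x * rt y * (rword s * F) \<le> denot (Sig_star M) * (denot (Sig_neq M) * Z2 M)"
    by (rule tracks_le_one_mult[rotated]) (simp add: denot_Sig_star one_le_kstar)
  then show ?thesis by (simp only: rword_lt_mult mismatch_def mult.assoc)
qed

lemma pop_match: "rword (x # s) * (lt x * F) = bword [x] * (rword s * F)"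
  by (simp only: rword_lt_mult) simp

lemma bword_mult_le_mismatch:
  assumes "w \<in> lists (symbols M)" "K \<le> D + mismatch M"
  shows "bword w * K \<le> bword w * D + mismatch M"
proof -
  have "bword w * K \<le> bword w * (D + mismatch M)" using assms(2) by (intro tracks_mult_mono) auto
  also have "\<dots> \<le> bword w * D + mismatch M"
    unfolding tracks_distribs by (intro add_mono order_refl bword_mult_mismatch assms(1))
  finally show ?thesis .
qed

text \<open>A further turn of the loop would dequeue x against the front y and fail, so only the
  exit from the loop can contribute to \<open>D\<close>.\<close>

lemma kstar_mismatch:
  assumes "x \<in> symbols M" "y # s \<in> lists (symbols M)" "x \<noteq> y" "kstar (bt x) * F \<le> Z2 M"
    and "rword (y # s) * F \<le> D + mismatch M"
  shows "rword (y # s) * (kstar (bt x) * F) \<le> D + mismatch M"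
proof -
  have "rword (y # s) * (lt x * (rt x * (kstar (bt x) * F))) \<le> mismatch M"
    by (intro pop_mismatch letter_mult_Z2_le assms)
  then show ?thesis
    unfolding rword_kstar_bt[of "y # s"] using assms(5) by (meson order_trans tracks_add_le_iff tracks_le_add2)
qed

text \<open>Each turn matches one x and moves it to the end of the queue. Leaving early keeps an x
  in front, which F cannot read by assumption; after n turns the front is no longer x and
  \<open>kstar_mismatch\<close> stops the loop.\<close>

lemma kstar_match:
  assumes "x \<in> symbols M" "v \<in> lists (symbols M)" "v \<noteq> []" "hd v \<noteq> x" "kstar (bt x) * F \<le> Z2 M"
    and F: "\<And>s. s \<in> lists (symbols M) \<Longrightarrow> rword (x # s) * F \<le> mismatch M"
  shows "rword (replicate n x @ v) * (kstar (bt x) * F) \<le>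
    bword (replicate n x) * (rword (v @ replicate n x) * F) + mismatch M"
  using assms(2-4)
\<comment> \<open>Each turn replaces v by \<open>v @ [x]\<close>, which has the same head since v is
  nonempty.\<close>
proof (induction n arbitrary: v)
  case 0
  then obtain y s where "v = y # s" by (cases v) auto
  with 0 kstar_mismatch[of x y s F "rword v * F"] assms(1,5) show ?case
    by (auto intro: tracks_le_add1)
next
  case (Suc n)
  let ?w = "replicate n x @ v"
  have "rword (x # ?w) * (lt x * (rt x * (kstar (bt x) * F))) =
      bword [x] * (rword (replicate n x @ (v @ [x])) * (kstar (bt x) * F))"
    by (simp only: pop_match rword_rt_mult append_assoc)
  also have "\<dots> \<le> bword [x] * (bword (replicate n x) * (rword ((v @ [x]) @ replicate n x) * F)) + mismatch M"
    using Suc.prems assms(1) by (intro bword_mult_le_mismatch Suc.IH) auto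
  also have "\<dots> = bword (replicate (Suc n) x) * (rword (v @ replicate (Suc n) x) * F) + mismatch M"
    by (simp add: mult.assoc)
  finally have 1: "rword (x # ?w) * (lt x * (rt x * (kstar (bt x) * F))) \<le> \<dots>" .
  have "?w \<in> lists (symbols M)" using Suc.prems assms(1) by auto
  then have "rword (x # ?w) * F \<le> mismatch M" by (rule F)
  with 1 show ?case
    unfolding replicate_Suc append_Cons rword_kstar_bt[of "x # ?w"]
    by (meson order_trans tracks_add_le_iff tracks_le_add2)
qed


section \<open>Loops and state letters of the instructions\<close>

lemma lists_intros:
  "replicate n SymA \<in> lists (symbols M)" "replicate n SymB \<in> lists (symbols M)"
  by (simp_all add: in_lists_conv_set)

lemma le_mismatch_trans: "S \<le> K + mismatch M \<Longrightarrow> K \<le> D + mismatch M \<Longrightarrow> S \<le> D + mismatch M"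
  by (meson order_trans tracks_add_le_iff tracks_le_add2)

lemma le_mismatch_weaken: "S \<le> mismatch M \<Longrightarrow> S \<le> D + mismatch M"
  by (rule order_trans[OF _ tracks_le_add2])

lemma tracks_mult_add_le: "x * F \<le> D \<Longrightarrow> x * G \<le> D \<Longrightarrow> x * (F + G) \<le> (D :: 'a tracks)"
  by (simp add: tracks_distribs)

lemma pop_state_mismatch:
  assumes "x # s \<in> lists (symbols M)" "x \<noteq> St q" "y \<in> symbols M" "q \<in> states M"
  shows "rword (x # s) * (rt y * lt (St q)) \<le> mismatch M"
proof -
  \<comment> \<open>Nothing follows the state letter, so the remainder in
    \<open>pop_mismatch\<close> is 1.\<close>
  have "rword (x # (s @ [y])) * (lt (St q) * 1) \<le> mismatch M"
    using assms by (intro pop_mismatch Z1_le_Z2 Z0_le_Z1 one_le_Z0) auto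
  then show ?thesis by (simp only: rword_rt_mult append_Cons mult_1_right)
qed

text \<open>Every branch of an instruction ends by writing a letter y and then reading the state.
  The value 0 for \<open>q \<noteq> q0\<close> expresses that the instruction of another state
  yields mismatches only.\<close>

lemma pop_state:
  assumes "St q0 # s \<in> lists (symbols M)" "y \<in> symbols M" "q \<in> states M"
  shows "rword (St q0 # s) * (rt y * lt (St q)) \<le>
    (if q = q0 then bword [St q0] * rword (s @ [y]) else 0) + mismatch M"
proof (cases "q = q0")
  case True
  have "rword (St q0 # s) * (rt y * lt (St q0)) = bword [St q0] * rword (s @ [y])"
    using pop_match[of "St q0" "s @ [y]" 1] by (simp only: rword_rt_mult append_Cons mult_1_right)
  then show ?thesis using True by (simp add: tracks_le_add1)
next
  case False
  then show ?thesis using pop_state_mismatch[OF assms(1) _ assms(2,3)] by simp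
qed

lemma letters_le_Z0:
  assumes "y \<in> symbols M" "q \<in> states M"
  shows "rt y * lt (St q) \<le> Z0 M"
  using assms letter_mult_Z0_le(1)[OF _ one_le_Z0, of "St q"] by (intro letter_mult_Z0_le) auto

lemma pop_b_mismatch:
  assumes "x # s \<in> lists (symbols M)" "x \<noteq> St q" "x \<noteq> SymB" "y \<in> symbols M" "q \<in> states M"
  shows "rword (x # s) * (kstar (bt SymB) * (rt y * lt (St q))) \<le> mismatch M"
  using kstar_mismatch[of SymB x s "rt y * lt (St q)" 0] assms pop_state_mismatch
  by (simp add: Z1_le_Z2 kstar_b_le_Z1 letters_le_Z0)

text \<open>By \<open>kstar_match\<close> the loop has to move all j letters b behind s, since
  \<open>St q\<close> cannot be read against b; then \<open>pop_state\<close> applies.\<close>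

lemma pop_b:
  assumes "q0 \<in> states M" "s \<in> lists (symbols M)" "y \<in> symbols M" "q \<in> states M"
  shows "rword (replicate j SymB @ St q0 # s) * (kstar (bt SymB) * (rt y * lt (St q))) \<le>
    (if q = q0 then bword (replicate j SymB @ [St q0]) * rword (s @ replicate j SymB @ [y]) else 0)
      + mismatch M"
proof -
  have "rword (replicate j SymB @ St q0 # s) * (kstar (bt SymB) * (rt y * lt (St q))) \<le>
    bword (replicate j SymB) * (rword ((St q0 # s) @ replicate j SymB) * (rt y * lt (St q))) + mismatch M"
    using assms by (intro kstar_match pop_state_mismatch Z1_le_Z2 kstar_b_le_Z1 letters_le_Z0) auto
  moreover have "bword (replicate j SymB) * (rword ((St q0 # s) @ replicate j SymB) * (rt y * lt (St q))) \<le>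
      bword (replicate j SymB) *
        (if q = q0 then bword [St q0] * rword ((s @ replicate j SymB) @ [y]) else 0) + mismatch M"
    unfolding append_Cons using assms by (intro bword_mult_le_mismatch pop_state) (auto simp: lists_intros)
  ultimately have "rword (replicate j SymB @ St q0 # s) * (kstar (bt SymB) * (rt y * lt (St q))) \<le>
      bword (replicate j SymB) *
        (if q = q0 then bword [St q0] * rword ((s @ replicate j SymB) @ [y]) else 0) + mismatch M"
    by (rule le_mismatch_trans)
  also have "\<dots> = (if q = q0 then bword (replicate j SymB @ [St q0]) * rword (s @ replicate j SymB @ [y]) else 0)
      + mismatch M"
    by (simp add: mult.assoc)
  finally show ?thesis .
qed

lemma hd_b_state: "hd (replicate j SymB @ St q # s) \<noteq> SymA"
  by (cases j) auto

text \<open>The a-loop with an arbitrary continuation F: \<open>kstar_match\<close> moves all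
  letters a behind s, and \<open>D\<close> bounds what F does with the resulting queue.\<close>

lemma pop_a:
  assumes "q0 \<in> states M" "s \<in> lists (symbols M)" "F \<le> Z1 M"
    and "\<And>s. s \<in> lists (symbols M) \<Longrightarrow> rword (SymA # s) * F \<le> mismatch M"
    and "rword (replicate j SymB @ St q0 # s @ replicate i SymA) * F \<le> D + mismatch M"
  shows "rword (replicate i SymA @ replicate j SymB @ St q0 # s) * (kstar (bt SymA) * F) \<le>
    bword (replicate i SymA) * D + mismatch M"
proof -
  have "rword (replicate i SymA @ replicate j SymB @ St q0 # s) * (kstar (bt SymA) * F) \<le>
      bword (replicate i SymA) *
        (rword ((replicate j SymB @ St q0 # s) @ replicate i SymA) * F) + mismatch M"
    using assms(1-4) hd_b_state
    by (intro kstar_match kstar_a_le_Z2) (auto simp: in_lists_conv_set)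
  moreover have "bword (replicate i SymA) *
        (rword ((replicate j SymB @ St q0 # s) @ replicate i SymA) * F) \<le>
      bword (replicate i SymA) * D + mismatch M"
    using assms(5) by (intro bword_mult_le_mismatch lists_intros) simp
  ultimately show ?thesis by (rule le_mismatch_trans)
qed

text \<open>The queue holds the unread part of the current configuration followed by the part of the
  next configuration that has already been written.\<close>

lemma conf_mult_instr:
  assumes q0: "q0 \<in> states M" and q: "q \<in> states M" and targets: "targets (instr M q) \<subseteq> states M"
  shows "\<exists>N. succ_elem M N \<and> rword (conf i j q0) * denot (instr_term (instr M q) \<odot> vl (St q)) \<le>
    (if q = q0 then bword (conf i j q0) * N else 0) + mismatch M"
proof -
  let ?a = "kstar (bt SymA)" and ?b = "kstar (bt SymB)"
  let ?as = "\<lambda>i. replicate i SymA" and ?bs = "\<lambda>j. replicate j SymB"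
  let ?goal = "\<lambda>i j N F. rword (conf i j q0) * F \<le>
    (if q = q0 then bword (conf i j q0) * N else 0) + mismatch M"
  have succ: "succ_elem M 0" "succ_elem M (rword [SymC x])"
    "q' \<in> states M \<Longrightarrow> succ_elem M (rword (conf i j q'))" for x i j q'
    unfolding succ_elem_def confs_def by blast+
  have ab: "?a * (?b * (rt (St q') * lt (St q))) \<le> Z2 M" "?b * (rt (St q') * lt (St q)) \<le> Z1 M"
    if "q' \<in> states M" for q'
    using that q by (simp_all add: kstar_a_le_Z2 kstar_b_le_Z1 letters_le_Z0)
  \<comment> \<open>Both counters are copied and only the state changes. This is what remains of a
    successful decrement of the first counter once its left a has been read.\<close>
  have full: "?goal i j (rword (conf i j q')) (?a * (?b * (rt (St q') * lt (St q))))"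
    if "q' \<in> states M" for q' i j
  proof -
    have "rword (?as i @ ?bs j @ St q0 # []) * (?a * (?b * (rt (St q') * lt (St q)))) \<le>
      bword (?as i) * (if q = q0 then bword (?bs j @ [St q0]) * rword (([] @ ?as i) @ ?bs j @ [St q']) else 0)
        + mismatch M"
      using that q0 q ab pop_b[of q0 "[] @ ?as i" "St q'" q j]
      by (intro pop_a pop_b_mismatch) (auto simp: lists_intros)
    then show ?thesis by (simp add: conf_def mult.assoc split: if_splits)
  qed
  show ?thesis
  proof (cases "instr M q" rule: instr_term.cases)
    case (1 q')
    with targets have q': "q' \<in> states M" by simp
    \<comment> \<open>The new a is written before anything is read, so it already stands behind the
      state, ahead of the i copied ones.\<close>
    have "rword (?as i @ ?bs j @ St q0 # [SymA]) * (?a * (?b * (rt (St q') * lt (St q)))) \<le>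
      bword (?as i) * (if q = q0 then bword (?bs j @ [St q0]) * rword (([SymA] @ ?as i) @ ?bs j @ [St q']) else 0)
        + mismatch M"
      using q' q0 q ab pop_b[of q0 "[SymA] @ ?as i" "St q'" q j]
      by (intro pop_a pop_b_mismatch) (auto simp: lists_intros)
    then have "?goal i j (rword (conf (Suc i) j q')) (denot (instr_term (instr M q) \<odot> vl (St q)))"
      by (simp add: conf_def mult.assoc 1 split: if_splits)
    with succ(3)[OF q'] show ?thesis by blast
  next
    case (2 q')
    with targets have q': "q' \<in> states M" by simp
    \<comment> \<open>The new b is written between the two loops, after the letters a have been
      copied and before any old b.\<close>
    let ?F = "rt SymB * (?b * (rt (St q') * lt (St q)))"
    have "rword (?as i @ ?bs j @ St q0 # []) * (?a * ?F) \<le>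
      bword (?as i) * (if q = q0 then bword (?bs j @ [St q0]) * rword ((?as i @ [SymB]) @ ?bs j @ [St q']) else 0)
        + mismatch M"
    proof (rule pop_a)
      show "?F \<le> Z1 M" using ab(2)[OF q'] by (intro letter_mult_Z1_le) auto
      show "rword (SymA # s) * ?F \<le> mismatch M" if "s \<in> lists (symbols M)" for s
        unfolding rword_rt_mult append_Cons using that q' q by (intro pop_b_mismatch) auto
      show "rword (?bs j @ St q0 # [] @ ?as i) * ?F \<le>
        (if q = q0 then bword (?bs j @ [St q0]) * rword ((?as i @ [SymB]) @ ?bs j @ [St q']) else 0) + mismatch M"
        using pop_b[of q0 "?as i @ [SymB]" "St q'" q j] q0 q' q
        unfolding rword_rt_mult by (simp add: lists_intros)
    qed (use q0 in auto)
    then have "?goal i j (rword (conf i (Suc j) q')) (denot (instr_term (instr M q) \<odot> vl (St q)))"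
      by (simp add: conf_def mult.assoc 2 replicate_app_Cons_same split: if_splits)
    with succ(3)[OF q'] show ?thesis by blast
  next
    case (3 q1 q2)
    with targets have q1: "q1 \<in> states M" and q2: "q2 \<in> states M" by simp_all
    let ?F = "?b * (rt (St q1) * lt (St q))"
    let ?G = "lt SymA * (?a * (?b * (rt (St q2) * lt (St q))))"
    have eq: "denot (instr_term (instr M q) \<odot> vl (St q)) = ?F + ?G"
      by (simp add: 3 tracks_distribs mult.assoc)
    \<comment> \<open>The zero branch has no a-loop and fails on a leading a; the other branch reads
      a first and fails on any other front. Exactly one of them survives.\<close>
    show ?thesis
    proof (cases i)
      case 0
      have F: "?goal i j (rword (conf 0 j q1)) ?F"
        using pop_b[of q0 "[]" "St q1" q j] q0 q1 q by (simp add: 0 conf_def split: if_splits)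
      obtain y s where ys: "conf 0 j q0 = y # s" "y \<noteq> SymA"
        by (cases j) (auto simp: conf_def)
      then have G: "rword (conf i j q0) * ?G \<le> mismatch M"
        unfolding 0 ys(1)
        using ys q0 ab(1)[OF q2] by (intro pop_mismatch) (auto simp: conf_def lists_intros simp flip: ys(1))
      have "?goal i j (rword (conf 0 j q1)) (?F + ?G)"
        by (rule tracks_mult_add_le[OF F le_mismatch_weaken[OF G]])
      with succ(3)[OF q1] show ?thesis unfolding eq by blast
    next
      case (Suc k)
      have w: "conf i j q0 = SymA # conf k j q0" by (simp add: Suc conf_def)
      have F: "rword (conf i j q0) * ?F \<le> mismatch M"
        unfolding w using q0 q1 q by (intro pop_b_mismatch) (auto simp: conf_def lists_intros)
      have "bword [SymA] * (rword (conf k j q0) * (?a * (?b * (rt (St q2) * lt (St q))))) \<le>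
          bword [SymA] * (if q = q0 then bword (conf k j q0) * rword (conf k j q2) else 0) + mismatch M"
        by (intro bword_mult_le_mismatch full[OF q2]) auto
      then have G: "?goal i j (rword (conf k j q2)) ?G"
        unfolding pop_match w by (simp add: mult.assoc split: if_splits)
      have "?goal i j (rword (conf k j q2)) (?F + ?G)"
        by (rule tracks_mult_add_le[OF le_mismatch_weaken[OF F] G])
      with succ(3)[OF q2] show ?thesis unfolding eq by blast
    qed
  next
    case (4 q1 q2)
    with targets have q1: "q1 \<in> states M" and q2: "q2 \<in> states M" by simp_all
    let ?F = "rt (St q1) * lt (St q)"
    let ?G = "lt SymB * (?b * (rt (St q2) * lt (St q)))"
    have eq: "denot (instr_term (instr M q) \<odot> vl (St q)) = ?a * ?F + ?a * ?G"
      by (simp add: 4 tracks_distribs mult.assoc)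
    have FG: "?F \<le> Z1 M" "?G \<le> Z1 M"
      using Z0_le_Z1[OF letters_le_Z0, of "St q1" q] q1 q by (simp_all add: letter_mult_Z1_le ab(2) q2)
    have aF: "rword (SymA # s) * ?F \<le> mismatch M" if "s \<in> lists (symbols M)" for s
      using that q1 q by (intro pop_state_mismatch) auto
    have aG: "rword (SymA # s) * ?G \<le> mismatch M" if "s \<in> lists (symbols M)" for s
      using that q2 ab(2) by (intro pop_mismatch Z1_le_Z2) auto
    \<comment> \<open>Both branches begin with the a-loop, so each reduces to its continuation H on
      the queue in which the letters a already stand behind the state.\<close>
    have step: "?goal i j N (?a * H)"
      if "H \<le> Z1 M" "\<And>s. s \<in> lists (symbols M) \<Longrightarrow> rword (SymA # s) * H \<le> mismatch M"
        "rword (?bs j @ St q0 # ?as i) * H \<le>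
          (if q = q0 then bword (?bs j @ [St q0]) * N else 0) + mismatch M" for H N
    proof -
      have "rword (?as i @ ?bs j @ St q0 # []) * (?a * H) \<le>
          bword (?as i) * (if q = q0 then bword (?bs j @ [St q0]) * N else 0) + mismatch M"
        using that q0 by (intro pop_a) auto
      then show ?thesis by (simp add: conf_def mult.assoc split: if_splits)
    qed
    show ?thesis
    proof (cases j)
      case 0
      have F: "?goal i j (rword (conf i 0 q1)) (?a * ?F)"
        using pop_state[of q0 "?as i" "St q1" q] q0 q1 q
        by (intro step FG aF aG) (simp_all add: 0 conf_def lists_intros split: if_splits)
      \<comment> \<open>With successor 0 the goal bounds the failing branch by
        \<open>mismatch\<close> whether or not \<open>q = q0\<close>, in the form that
        \<open>step\<close> requires.\<close>
      have "?goal i j 0 (?a * ?G)"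
      proof (intro step FG aF aG)
        have "rword (St q0 # ?as i) * ?G \<le> mismatch M"
          using q0 q2 q ab(2) by (intro pop_mismatch Z1_le_Z2) (auto simp: lists_intros)
        then show "rword (?bs j @ St q0 # ?as i) * ?G \<le>
          (if q = q0 then bword (?bs j @ [St q0]) * 0 else 0) + mismatch M" using 0 by (cases "q = q0") simp_all
      qed
      then have G: "rword (conf i j q0) * (?a * ?G) \<le> mismatch M" by (cases "q = q0") simp_all
      have "?goal i j (rword (conf i 0 q1)) (?a * ?F + ?a * ?G)"
        by (rule tracks_mult_add_le[OF F le_mismatch_weaken[OF G]])
      with succ(3)[OF q1] show ?thesis unfolding eq by blast
    next
      case (Suc k)
      have "?goal i j 0 (?a * ?F)"
      proof (intro step FG aF aG)
        have "rword (SymB # ?bs k @ St q0 # ?as i) * ?F \<le> mismatch M"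
          using q0 q1 q by (intro pop_state_mismatch) (auto simp: lists_intros)
        then show "rword (?bs j @ St q0 # ?as i) * ?F \<le>
          (if q = q0 then bword (?bs j @ [St q0]) * 0 else 0) + mismatch M" using Suc by (cases "q = q0") simp_all
      qed
      then have F: "rword (conf i j q0) * (?a * ?F) \<le> mismatch M" by (cases "q = q0") simp_all
      have G: "?goal i j (rword (conf i k q2)) (?a * ?G)"
      proof (intro step FG aF aG)
        have "bword [SymB] * (rword (?bs k @ St q0 # ?as i) * (?b * (rt (St q2) * lt (St q)))) \<le>
          bword [SymB] * (if q = q0 then bword (?bs k @ [St q0]) * rword (?as i @ ?bs k @ [St q2]) else 0)
            + mismatch M"
          using q0 q2 q by (intro bword_mult_le_mismatch pop_b) (auto simp: lists_intros)
        then show "rword (?bs j @ St q0 # ?as i) * ?G \<le>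
          (if q = q0 then bword (?bs j @ [St q0]) * rword (conf i k q2) else 0) + mismatch M"
          unfolding Suc replicate_Suc append_Cons pop_match
          by (simp add: conf_def mult.assoc split: if_splits)
      qed
      have "?goal i j (rword (conf i k q2)) (?a * ?F + ?a * ?G)"
        by (rule tracks_mult_add_le[OF le_mismatch_weaken[OF F] G])
      with succ(3)[OF q2] show ?thesis unfolding eq by blast
    qed
  next
    case (5 x)
    have eq: "denot (instr_term (instr M q) \<odot> vl (St q)) = rt (SymC x) * lt (St q)"
      by (simp add: 5)
    \<comment> \<open>A halting instruction reads only its state, so it matches the bare state; with
      a nonzero counter the front is a or b, and the successor is 0.\<close>
    show ?thesis
    proof (cases "i = 0 \<and> j = 0")
      case True
      then have "?goal i j (rword [SymC x]) (rt (SymC x) * lt (St q))"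
        using pop_state[of q0 "[]" "SymC x" q] q0 q by (simp add: conf_def split: if_splits)
      with succ(2) show ?thesis unfolding eq by blast
    next
      case False
      obtain y s where ys: "conf i j q0 = y # s" "y \<noteq> St q"
        using False by (cases i; cases j) (auto simp: conf_def)
      have "rword (y # s) * (rt (SymC x) * lt (St q)) \<le> mismatch M"
        using ys q0 q by (intro pop_state_mismatch) (auto simp: conf_def lists_intros simp flip: ys(1))
      then have "?goal i j 0 (rt (SymC x) * lt (St q))" by (cases "q = q0") (simp_all add: ys(1))
      with succ(1) show ?thesis unfolding eq by blast
    qed
  qed
qed

text \<open>Every branch reads a left letter, be it a, b or its state, and the first one it reads
  differs from the halting symbol in front.\<close>

lemma halt_mult_instr:
  assumes q: "q \<in> states M" and targets: "targets (instr M q) \<subseteq> states M"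
  shows "rword [SymC x] * denot (instr_term (instr M q) \<odot> vl (St q)) \<le> mismatch M"
proof -
  have fin: "rword (SymC x # s) * (rt y * lt (St q)) \<le> mismatch M"
    if "s \<in> lists (symbols M)" "y \<in> symbols M" for s y
    using that q by (intro pop_state_mismatch) auto
  have b: "rword (SymC x # s) * (kstar (bt SymB) * (rt y * lt (St q))) \<le> mismatch M"
    if "s \<in> lists (symbols M)" "y \<in> symbols M" for s y
    using that q by (intro pop_b_mismatch) auto
  have a: "rword (SymC x # s) * (kstar (bt SymA) * F) \<le> mismatch M"
    if "s \<in> lists (symbols M)" "F \<le> Z1 M" "rword (SymC x # s) * F \<le> mismatch M" for s F
    using kstar_mismatch[of SymA "SymC x" s F 0] that by (simp add: kstar_a_le_Z2)
  have l: "rword (SymC x # s) * (lt y * F) \<le> mismatch M"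
    if "s \<in> lists (symbols M)" "y \<in> {SymA, SymB}" "F \<le> Z2 M" for s y F
    using that by (intro pop_mismatch) auto
  note le = kstar_a_le_Z2 kstar_b_le_Z1 letters_le_Z0 Z1_le_Z2 Z0_le_Z1 letter_mult_Z1_le
  have push: "rword [SymC x] * (rt y * F) = rword (SymC x # [y]) * F" for y F
    by (simp add: mult.assoc)
  show ?thesis
  proof (cases "instr M q" rule: instr_term.cases)
    case (1 q')
    with targets q have "rword [SymC x] * (rt SymA * (kstar (bt SymA) * (kstar (bt SymB) * (rt (St q') * lt (St q)))))
      \<le> mismatch M" unfolding push by (intro a b le) auto
    then show ?thesis by (simp add: 1 mult.assoc)
  next
    case (2 q')
    let ?F = "kstar (bt SymB) * (rt (St q') * lt (St q))"
    have "rt SymB * ?F \<le> Z1 M" using 2 targets q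
      by (intro letter_mult_Z1_le kstar_b_le_Z1 letters_le_Z0) auto
    moreover have "rword [SymC x] * (rt SymB * ?F) \<le> mismatch M"
      unfolding push using 2 targets by (intro b) auto
    ultimately have "rword [SymC x] * (kstar (bt SymA) * (rt SymB * ?F)) \<le> mismatch M"
      by (intro a) auto
    then show ?thesis by (simp add: 2 mult.assoc)
  next
    case (3 q1 q2)
    with targets q have "rword [SymC x] * (kstar (bt SymB) * (rt (St q1) * lt (St q))) \<le> mismatch M"
      and "rword [SymC x] * (lt SymA * (kstar (bt SymA) * (kstar (bt SymB) * (rt (St q2) * lt (St q))))) \<le> mismatch M"
      by (intro l b le; auto)+
    then show ?thesis by (simp add: 3 mult.assoc tracks_distribs)
  next
    case (4 q1 q2)
    with targets q have "rword [SymC x] * (kstar (bt SymA) * (rt (St q1) * lt (St q))) \<le> mismatch M"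
      and "rword [SymC x] * (kstar (bt SymA) * (lt SymB * (kstar (bt SymB) * (rt (St q2) * lt (St q))))) \<le> mismatch M"
      by (intro a l fin le; auto)+
    then show ?thesis by (simp add: 4 mult.assoc tracks_distribs)
  next
    case (5 y)
    then show ?thesis using fin[of "[]" "SymC y"] by simp
  qed
qed

section \<open>Runs of the machine\<close>

lemma mult_RM_le:
  assumes "\<And>q. q \<in> states M \<Longrightarrow> rword w * denot (instr_term (instr M q) \<odot> vl (St q)) \<le> y"
  shows "rword w * denot (RM M) \<le> y"
proof -
  have "rword w * sum_list (map f qs) = sum_list (map (\<lambda>q. rword w * f q) qs)"
    for f :: "nat \<Rightarrow> sym tracks" and qs
    by (induction qs) (auto simp: tracks_distribs)
  then have "rword w * denot (RM M) =
      sum_list (map (\<lambda>q. rword w * denot (instr_term (instr M q) \<odot> vl (St q))) (state_list M))"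
    by (simp add: RM_def denot_ksum comp_def)
  then show ?thesis using assms finite_states by (auto intro!: tracks_sum_list_le)
qed

lemma halt_mult_RM:
  assumes "\<forall>q\<in>states M. targets (instr M q) \<subseteq> states M"
  shows "rword [SymC x] * denot (RM M) \<le> mismatch M"
  using assms by (intro mult_RM_le halt_mult_instr) auto

text \<open>Determinism: only the summand of the current state contributes a successor, all others
  are mismatches.\<close>

lemma conf_mult_RM:
  assumes targets: "\<forall>q\<in>states M. targets (instr M q) \<subseteq> states M" and "w \<in> confs M"
  obtains N where "succ_elem M N" "rword w * denot (RM M) \<le> bword w * N + mismatch M"
proof -
  obtain i j q0 where w: "w = conf i j q0" and q0: "q0 \<in> states M"
    using assms(2) by (auto simp: confs_def)
  obtain N where N: "succ_elem M N" "rword w * denot (instr_term (instr M q0) \<odot> vl (St q0)) \<le>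
      bword w * N + mismatch M"
    using conf_mult_instr[OF q0 q0, of i j] targets q0 w by auto
  have "rword w * denot (instr_term (instr M q) \<odot> vl (St q)) \<le> bword w * N + mismatch M"
    if "q \<in> states M" for q
  proof (cases "q = q0")
    case False
    then have "rword w * denot (instr_term (instr M q) \<odot> vl (St q)) \<le> mismatch M"
      using conf_mult_instr[OF q0 that, of i j] targets that w by auto
    then show ?thesis by (rule order_trans) (rule tracks_le_add2)
  qed (use N in simp)
  then show thesis using that[OF N(1) mult_RM_le] by blast
qed

text \<open>In the model \<open>Sig_star\<close> is diagonal and \<open>Sig_neq\<close> consists of
  pairs of distinct letters, so the two words differ at a common position.\<close>

lemma trel_mismatchE:
  assumes "(u, v) \<in> trel (mismatch M)"
  obtains p x y u' v' where "u = p @ x # u'" "v = p @ y # v'" "x \<noteq> y"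
proof -
  have "p = p'" if "(p, p') \<in> iter (\<Union>x\<in>S. {([x], [x])})" for p p' and S :: "sym set"
    using that by induction auto
  moreover have "trel (denot (Sig_star M)) = iter (\<Union>x\<in>set (sym_list M). {([x], [x])})"
    by (simp add: denot_Sig_star trel_sum_list cat_def)
  ultimately have star: "p = p'" if "(p, p') \<in> trel (denot (Sig_star M))" for p p'
    using that by auto
  have neq: "\<exists>x y. x \<noteq> y \<and> e = [x] \<and> e' = [y]" if "(e, e') \<in> trel (denot (Sig_neq M))" for e e'
    using that by (auto simp: Sig_neq_def denot_ksum trel_sum_list cat_def split: if_splits)
  from assms obtain p p' e e' u' v' where "u = p @ e @ u'" "v = p' @ e' @ v'"
    "(p, p') \<in> trel (denot (Sig_star M))" "(e, e') \<in> trel (denot (Sig_neq M))"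
    unfolding mismatch_def by (auto elim!: catE)
  with star neq that show thesis by fastforce
qed

text \<open>A pair \<open>(w, w w')\<close> cannot belong to the relation of \<open>mismatch M\<close>, so the relational model forces
  the successor of \<open>w\<close> in \<open>conf_mult_RM\<close> to be \<open>w'\<close>.\<close>

lemma step_mult_RM:
  assumes targets: "\<forall>q\<in>states M. targets (instr M q) \<subseteq> states M"
    and w: "w \<in> confs M \<union> range (\<lambda>x. [SymC x])"
    and step: "lword w * rword w' \<le> denot (RM M)"
  shows "w \<in> confs M" "w' \<in> confs M \<union> range (\<lambda>x. [SymC x])"
    "rword w * denot (RM M) \<le> bword w * rword w' + mismatch M"
proof -
  \<comment> \<open>Multiplying the step by \<open>rword w\<close> lets w be read from the queue,
    which yields the pair (w, w w') in the model.\<close>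
  have "bword w * rword w' \<le> rword w * denot (RM M)"
    using tracks_mult_mono[OF order_refl[of "rword w"] step]
    by (simp add: mult.assoc[symmetric] rword_lword)
  from trel_mono[OF this] have mem: "(w, w @ w') \<in> trel (rword w * denot (RM M))"
    by (auto simp: cat_def)
  \<comment> \<open>w is a prefix of w w', so the two never differ at a common position.\<close>
  have not: "(w, w @ w') \<notin> trel (mismatch M)"
    by (auto elim!: trel_mismatchE)
  \<comment> \<open>For a halting symbol the whole product lies below \<open>mismatch\<close>,
    contrary to the pair just found.\<close>
  show conf: "w \<in> confs M"
    using w trel_mono[OF halt_mult_RM[OF targets]] mem not by auto
  from targets conf obtain N where N: "succ_elem M N"
    "rword w * denot (RM M) \<le> bword w * N + mismatch M" by (rule conf_mult_RM)
  from trel_mono[OF N(2)] mem not have "(w, w @ w') \<in> cat {(w, w)} (trel N)" by auto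
  with N(1) have "N = rword w' \<and> w' \<in> confs M \<union> range (\<lambda>x. [SymC x])"
    unfolding succ_elem_def cat_def by auto
  with N(2) show "w' \<in> confs M \<union> range (\<lambda>x. [SymC x])"
    "rword w * denot (RM M) \<le> bword w * rword w' + mismatch M" by auto
qed

section \<open>Words below the bound and induction along the run\<close>

lemma rword_replicate_le_kstar: "rword (replicate n x) \<le> kstar (rt x)"
proof (induction n)
  case (Suc n)
  then have "rt x * rword (replicate n x) \<le> rt x * kstar (rt x)" by (intro tracks_mult_mono) auto
  then show ?case using mult_kstar_le[OF order_refl] order_trans by fastforce
qed (simp add: one_le_kstar)

lemma denot_rterm_CM:
  "denot (rterm (CM M)) = kstar (rt SymA) * kstar (rt SymB) * sum_list (map (\<lambda>q. rt (St q)) (state_list M))"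
proof -
  have "denot (rterm (ksum (map (\<lambda>q. Var (St q)) qs))) = sum_list (map (\<lambda>q. rt (St q)) qs)" for qs
    by (induction qs) (auto simp: rterm_def ksum_def)
  then show ?thesis by (simp add: CM_def rterm_def)
qed

lemma conf_le_rterm_CM:
  assumes "w \<in> confs M"
  shows "rword w \<le> denot (rterm (CM M))"
proof -
  obtain i j q where w: "w = conf i j q" and q: "q \<in> states M"
    using assms by (auto simp: confs_def)
  have "rt (St q) \<le> sum_list (map (\<lambda>q. rt (St q)) (state_list M))"
    using q finite_states by (intro tracks_le_sum_list) auto
  then have "rword (replicate i SymA) * rword (replicate j SymB) * rt (St q) \<le> denot (rterm (CM M))"
    unfolding denot_rterm_CM by (intro tracks_mult_mono rword_replicate_le_kstar)
  then show ?thesis by (simp add: w conf_def mult.assoc)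
qed

lemma rword_le_bound:
  assumes "w \<in> confs M \<or> w = [SymC True]"
  shows "rword w \<le> bound M"
proof -
  have "rword w \<le> denot (rterm (CM M \<oplus> Var (SymC True)))"
    using assms conf_le_rterm_CM by (auto simp: rterm_def intro: order_trans tracks_le_add1 tracks_le_add2)
  then have "rword w \<le> denot (Sig_star M) * denot (rterm (CM M \<oplus> Var (SymC True)))"
    by (rule tracks_le_one_mult[rotated]) (simp add: denot_Sig_star one_le_kstar)
  then show ?thesis unfolding bound_def by (rule order_trans) (rule tracks_le_add1)
qed

lemma bword_mult_bound:
  assumes "w \<in> lists (symbols M)"
  shows "bword w * bound M \<le> bound M"
proof -
  have "bword w * (mismatch M * F) \<le> mismatch M * F" for F
    using tracks_mult_mono[OF bword_mult_mismatch[OF assms] order_refl] by (simp add: mult.assoc)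
  then show ?thesis
    unfolding bound_def tracks_distribs
    by (intro add_mono bword_mult_Sig_star_mult assms)
qed

lemma confs_lists: "confs M \<union> range (\<lambda>x. [SymC x]) \<subseteq> lists (symbols M)"
  by (auto simp: confs_def conf_def)

text \<open>Induction on the run, backwards from c_1. Of 1 + R R^* the summand 1 leaves the word
  itself, which is below the bound. The other yields w w'_r R^* and a mismatch followed by R^*; the
  induction hypothesis bounds w'_r R^*, and the bound absorbs w.\<close>

lemma rword_kstar_RM_le_bound:
  assumes targets: "\<forall>q\<in>states M. targets (instr M q) \<subseteq> states M"
    and "w \<in> confs M \<union> range (\<lambda>x. [SymC x])"
    and "({w}, {[SymC True]}) \<in> (trans_rel (Sig M) (RM M))\<^sup>*"
  shows "rword w * kstar (denot (RM M)) \<le> bound M"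
proof -
  let ?R = "denot (RM M)"
  have unfold: "rword w * kstar ?R = rword w + rword w * ?R * kstar ?R" for w
    by (subst kstar_unfold) (simp add: tracks_distribs mult.assoc)
  have mism: "mismatch M * kstar ?R \<le> bound M" unfolding bound_def by (rule tracks_le_add2)
  have "\<forall>w \<in> confs M \<union> range (\<lambda>x. [SymC x]). c = {w} \<longrightarrow> rword w * kstar ?R \<le> bound M"
    if "(c, {[SymC True]}) \<in> (trans_rel (Sig M) (RM M))\<^sup>*" for c
    using that
  proof (induction rule: converse_rtrancl_induct)
    case base
    have "rword [SymC True] * ?R * kstar ?R \<le> bound M"
      by (intro order_trans[OF _ mism] tracks_mult_mono halt_mult_RM targets order_refl)
    then have "rword [SymC True] * kstar ?R \<le> bound M"
      unfolding unfold tracks_add_le_iff using rword_le_bound by blast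
    then show ?case by auto
  next
    case (step c d)
    show ?case
    proof (intro ballI impI)
      fix w assume w: "w \<in> confs M \<union> range (\<lambda>x. [SymC x])" and c: "c = {w}"
      from step(1) obtain v w' where "c = str_class (Sig M) v" "d = str_class (Sig M) w'"
        and v: "v \<in> lists (symbols M)" and w': "w' \<in> lists (symbols M)"
        and le: "pka_le (ddot (Sig M)) (lterm (str_term v) \<odot> rterm (str_term w')) (RM M)"
        unfolding trans_rel_def by auto
      \<comment> \<open>The alphabet is discrete, so classes of strings are singletons.\<close>
      then have d: "d = {w'}" and vw: "v = w"
        using c str_class_discrete[OF v] str_class_discrete[OF w'] unfolding Sig_eq by simp_all
      have "lword w * rword w' \<le> ?R"
        using denot_le_if_pka_le[OF le[unfolded Sig_eq]] vw by simp
      note s = step_mult_RM[OF targets w this]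
      have "rword w * ?R * kstar ?R \<le> (bword w * rword w' + mismatch M) * kstar ?R"
        by (intro tracks_mult_mono s order_refl)
      also have "\<dots> = bword w * (rword w' * kstar ?R) + mismatch M * kstar ?R"
        by (simp add: tracks_distribs mult.assoc)
      also have "\<dots> \<le> bword w * bound M + bound M"
        using step.IH s(2) d mism by (intro add_mono tracks_mult_mono order_refl) auto
      also have "\<dots> \<le> bound M"
        using bword_mult_bound w confs_lists by auto
      \<comment> \<open>A string that makes a step is a configuration by \<open>s(1)\<close>; this
        excludes c_0, which \<open>rword_le_bound\<close> leaves out.\<close>
      finally show "rword w * kstar ?R \<le> bound M"
        unfolding unfold tracks_add_le_iff using rword_le_bound s(1) by blast
    qed
  qed
  with assms(2,3) show ?thesis by blast
qed

text \<open>On the right track the model reads off the language of \<open>TM M\<close> in the second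
  component: configurations, c_0 and c_1.\<close>

lemma word_in_TM:
  assumes "pka_le (Sig M) (str_term w) (TM M)"
  shows "w \<in> confs M \<union> range (\<lambda>x. [SymC x])"
proof -
  have "rword w \<le> denot (rterm (TM M))"
    using pka_le_rterm[OF assms[unfolded Sig_eq]] by simp
  then have mem: "([], w) \<in> trel (denot (rterm (TM M)))"
    using trel_mono by fastforce
  have iter: "\<exists>n. v = replicate n x" if "(u, v) \<in> iter {([], [x])}" for u v and x :: sym
    using that
  proof induction
    case (2 u v u' v')
    then obtain n where "v' = replicate n x" by blast
    with 2 have "v @ v' = replicate (Suc n) x" by simp
    then show ?case by blast
  qed (auto intro: exI[of _ 0])
  have "denot (rterm (TM M)) = denot (rterm (CM M)) + rt (SymC False) + rt (SymC True)"
    by (simp add: TM_def rterm_def)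
  with mem consider "([], w) \<in> trel (denot (rterm (CM M)))" | x where "w = [SymC x]"
    by auto
  then show ?thesis
  proof cases
    case 1
    then obtain u v v' q where "w = (v @ v') @ [St q]" "(u, v) \<in> iter {([], [SymA])}"
      "(u, v') \<in> iter {([], [SymB])}" "q \<in> states M"
      unfolding denot_rterm_CM using finite_states by (auto simp: trel_sum_list elim!: catE)
    moreover obtain m n where "v = replicate m SymA" "v' = replicate n SymB"
      using calculation iter by blast
    ultimately show ?thesis by (auto simp: confs_def conf_def)
  qed auto
qed

end

section \<open>Alphabets of the terms and the final inequality\<close>

lemma set_ktm_ksum [simp]: "set_ktm (ksum ts) = (\<Union>t\<in>set ts. set_ktm t)"
  by (induction ts) (auto simp: ksum_def)

lemma set_ktm_ksubst: "set_ktm (ksubst h t) = (\<Union>x\<in>set_ktm t. set_ktm (h x))"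
  by (induction t) auto

lemma set_ktm_str_term [simp]: "set_ktm (str_term w) = set w"
  by (induction w) (auto simp: str_term_def)

lemma set_ktm_fold: "set_ktm (fold (\<lambda>q t. t \<oplus> f q) qs t) = set_ktm t \<union> (\<Union>q\<in>set qs. set_ktm (f q))"
  by (induction qs arbitrary: t) auto

context
  fixes M :: machine
  assumes M: "two_counter_machine M"
begin

lemma in_terms_iff: "t \<in> terms (ddot (Sig M)) \<longleftrightarrow> set_ktm t \<subseteq> Lft ` symbols M \<union> Rgt ` symbols M"
  by (simp add: terms_def ddot_def)

lemma rterm_in_terms: "set_ktm t \<subseteq> symbols M \<Longrightarrow> rterm t \<in> terms (ddot (Sig M))"
  by (auto simp: in_terms_iff rterm_def set_ktm_ksubst)

lemma finite_states_M: "finite (states M)"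
  using M by (simp add: two_counter_machine_def)

lemma set_instr_term:
  assumes "q \<in> states M"
  shows "set_ktm (instr_term (instr M q)) \<subseteq> Lft ` symbols M \<union> Rgt ` symbols M"
proof -
  have "targets (instr M q) \<subseteq> states M" using M assms by (auto simp: two_counter_machine_def)
  then show ?thesis by (cases "instr M q" rule: instr_term.cases) auto
qed

lemma machine_terms:
  "RM M \<in> terms (ddot (Sig M))" "transitions M \<in> terms (ddot (Sig M))"
  "tail_term M \<in> terms (ddot (Sig M))" "Sig_star M \<in> terms (ddot (Sig M))"
  "Sig_neq M \<in> terms (ddot (Sig M))" "rterm (CM M \<oplus> Var (SymC True)) \<in> terms (ddot (Sig M))"
proof -
  note fin = finite_states_M
  show "RM M \<in> terms (ddot (Sig M))" "transitions M \<in> terms (ddot (Sig M))"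
    using set_instr_term fin by (auto simp: in_terms_iff RM_def transitions_def set_ktm_fold dest!: subsetD)
  have "set_ktm (track_letters M) \<subseteq> Lft ` symbols M \<union> Rgt ` symbols M"
    using fin by (auto simp: track_letters_def set_ktm_fold)
  then show "tail_term M \<in> terms (ddot (Sig M))"
    by (auto simp: in_terms_iff tail_term_def)
  show "Sig_star M \<in> terms (ddot (Sig M))" "Sig_neq M \<in> terms (ddot (Sig M))"
    using set_sym_list[OF fin]
    by (auto simp: in_terms_iff Sig_star_def Sig_neq_def bterm_def set_ktm_ksubst split: if_splits)
  show "rterm (CM M \<oplus> Var (SymC True)) \<in> terms (ddot (Sig M))"
    using fin by (intro rterm_in_terms) (auto simp: CM_def)
qed

text \<open>\<open>word_in_TM\<close> gives the shape of the string, the bound holds over all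
  symbols, and \<open>pka_le_if_denot_le\<close> brings it back to the alphabet of M. In the last
  factor \<open>transitions\<close> may replace \<open>RM\<close>, as their denotations
  agree.\<close>

lemma halting_inequality:
  assumes "w \<in> lists (carr (Sig M))" "pka_le (Sig M) (str_term w) (TM M)"
    and "(str_class (Sig M) w, str_class (Sig M) [SymC True]) \<in> (trans_rel (Sig M) (RM M))\<^sup>*"
  shows "pka_le (ddot (Sig M)) (rterm (str_term w) \<odot> KStar (RM M))
    (Sig_star M \<odot> rterm (CM M \<oplus> Var (SymC True)) \<oplus>
      Sig_star M \<odot> Sig_neq M \<odot> (tail_term M \<odot> KStar (transitions M)))"
proof -
  have "str_class (Sig M) w = {w}" "str_class (Sig M) [SymC True] = {[SymC True]}"
    using assms(1) unfolding carr_Sig by (auto simp: Sig_eq intro!: str_class_discrete)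
  with assms(3) have "({w}, {[SymC True]}) \<in> (trans_rel (Sig M) (RM M))\<^sup>*" by simp
  then have "rword w * kstar (denot (RM M)) \<le> bound M"
    using M word_in_TM[OF finite_states_M assms(2)]
    by (intro rword_kstar_RM_le_bound finite_states_M) (auto simp: two_counter_machine_def)
  moreover have "rterm (str_term w) \<in> terms (ddot (Sig M))"
    using assms(1) by (intro rterm_in_terms) auto
  ultimately show ?thesis
    unfolding Sig_eq
    by (intro pka_le_if_denot_le; fold Sig_eq)
      (use machine_terms in \<open>auto simp: bound_def mismatch_def denot_tail_term denot_transitions mult.assoc terms_def\<close>)
qed

end

theorem mainTheorem3:
  shows "\<exists>\<rho> :: machine \<Rightarrow> sym list \<Rightarrow> sym dd ktm.
    (\<exists>f. partial_recursive f \<and>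
      (\<forall>M w. two_counter_machine M \<longrightarrow> w \<in> lists (carr (Sig M)) \<longrightarrow>
        pka_le (Sig M) (str_term w) (TM M) \<longrightarrow>
        f (input_code M w) = Some (term_code (\<rho> M w)))) \<and>
    (\<forall>M w. two_counter_machine M \<longrightarrow> w \<in> lists (carr (Sig M)) \<longrightarrow>
      pka_le (Sig M) (str_term w) (TM M) \<longrightarrow>
      \<rho> M w \<in> terms (ddot (Sig M)) \<and>
      ((str_class (Sig M) w, str_class (Sig M) [SymC True]) \<in> (trans_rel (Sig M) (RM M))\<^sup>* \<longrightarrow>
        pka_le (ddot (Sig M))
          (rterm (str_term w) \<odot> KStar (RM M))
          (Sig_star M \<odot> rterm (CM M \<oplus> Var (SymC True)) \<oplus> Sig_star M \<odot> Sig_neq M \<odot> \<rho> M w)))"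
proof -
  let ?\<rho> = "\<lambda>M (w :: sym list). tail_term M \<odot> KStar (transitions M)"
  obtain f where f: "recursive f" "\<And>M w. f (input_code M w) = term_code (?\<rho> M w)"
    using recursive_tail_term by blast
  have "?\<rho> M w \<in> terms (ddot (Sig M))" if "two_counter_machine M" for M w
    using machine_terms[OF that] by (auto simp: terms_def)
  with f halting_inequality show ?thesis
    by (intro exI[of _ ?\<rho>] conjI exI[of _ "\<lambda>n. Some (f n)"]) (auto simp: recursive_def)
qed

end
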